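(* Let $p$ be a prime and let $G$ be a finitely generated pro-$p$ group such that $\mathrm{Aut}(G)$ acts transitively on the set of non-trivial elements of $G/\Phi(G)$. Let $1\neq u\in G$. If $\varphi$ is an endomorphism of $G$ such that $\varphi(\mathrm{Orb}(u))\subseteq \mathrm{Orb}(u)$, then $\varphi$ is an automorphism.
   Context: Homomorphisms between profinite groups are continuous; $\mathrm{Aut}(G)$ is the group of continuous automorphisms of $G$. $\Phi(G)$ is the Frattini subgroup of $G$, and $\mathrm{Aut}(G)$ acts on $G/\Phi(G)$ in the induced way. The automorphic orbit of $g\in G$ is $\mathrm{Orb}(g)=\{\alpha(g)\mid \alpha\in \mathrm{Aut}(G)\}$. *)

theory Defs
  imports "HOL-Analysis.Analysis" "HOL-Algebra.Generated_Groups" "HOL-Computational_Algebra.Primes"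
begin

locale topological_group = group G for G (structure) +
  fixes T :: "'a topology"
  assumes topspace_eq_carrier: "topspace T = carrier G"
    and continuous_mult: "continuous_map (prod_topology T T) T (\<lambda>(x, y). x \<otimes> y)"
    and continuous_inv: "continuous_map T T (\<lambda>x. inv x)"

locale profinite_group = topological_group +
  assumes compact: "compact_space T"
    and Hausdorff: "Hausdorff_space T"
    and totally_disconnected: "\<And>S x y. \<lbrakk>connectedin T S; x \<in> S; y \<in> S\<rbrakk> \<Longrightarrow> x = y"

text \<open>Infinite quotients have \<^const>\<open>order\<close> equal to 0, so the last assumption
  also says that the quotient is finite.\<close>

locale pro_p_group = profinite_group +
  fixes p :: nat
  assumes prime_p: "prime p"
    and open_normal_index: "\<And>N. \<lbrakk>N \<lhd> G; openin T N\<rbrakk> \<Longrightarrow> \<exists>k. order (G Mod N) = p ^ k"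

text \<open>As usual for profinite groups, generation is meant topologically.\<close>

definition top_finitely_generated :: "('a, 'b) monoid_scheme \<Rightarrow> 'a topology \<Rightarrow> bool" where
  "top_finitely_generated G T \<longleftrightarrow>
     (\<exists>S. finite S \<and> S \<subseteq> carrier G \<and> T closure_of (generate G S) = carrier G)"

definition cont_End :: "('a, 'b) monoid_scheme \<Rightarrow> 'a topology \<Rightarrow> ('a \<Rightarrow> 'a) set" where
  "cont_End G T = {\<phi> \<in> hom G G. continuous_map T T \<phi>}"

text \<open>Maps are not required to be extensional: only their values on the carrier matter.\<close>

definition cont_Aut :: "('a, 'b) monoid_scheme \<Rightarrow> 'a topology \<Rightarrow> ('a \<Rightarrow> 'a) set" where
  "cont_Aut G T = {\<alpha> \<in> iso G G. homeomorphic_map T T \<alpha>}"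

definition maximal_open_subgroup ::
    "('a, 'b) monoid_scheme \<Rightarrow> 'a topology \<Rightarrow> 'a set \<Rightarrow> bool" where
  "maximal_open_subgroup G T M \<longleftrightarrow>
     subgroup M G \<and> openin T M \<and> M \<noteq> carrier G \<and>
     (\<forall>H. subgroup H G \<and> openin T H \<and> M \<subseteq> H \<longrightarrow> H = M \<or> H = carrier G)"

text \<open>The intersection with the carrier makes the Frattini subgroup of the trivial group trivial,
  rather than the whole type.\<close>

definition Frattini :: "('a, 'b) monoid_scheme \<Rightarrow> 'a topology \<Rightarrow> 'a set" where
  "Frattini G T = carrier G \<inter> \<Inter> {M. maximal_open_subgroup G T M}"

definition Orb :: "('a, 'b) monoid_scheme \<Rightarrow> 'a topology \<Rightarrow> 'a \<Rightarrow> 'a set" where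
  "Orb G T g = {\<alpha> g | \<alpha>. \<alpha> \<in> cont_Aut G T}"

text \<open>An automorphism acts on the quotient by the Frattini subgroup by taking images of cosets;
  the lemma \<open>image_Frattini_coset\<close> below says that this is the induced action.\<close>

definition Aut_transitive_mod_Frattini ::
    "('a, 'b) monoid_scheme \<Rightarrow> 'a topology \<Rightarrow> bool" where
  "Aut_transitive_mod_Frattini G T \<longleftrightarrow>
     (let Q = G Mod Frattini G T in
      \<forall>A \<in> carrier Q - {\<one>\<^bsub>Q\<^esub>}. \<forall>B \<in> carrier Q - {\<one>\<^bsub>Q\<^esub>}.
        \<exists>\<alpha> \<in> cont_Aut G T. \<alpha> ` A = B)"

lemma (in topological_group) maximal_open_subgroup_image:
  assumes a: "\<alpha> \<in> cont_Aut G T" and M: "maximal_open_subgroup G T M"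
  shows "maximal_open_subgroup G T (\<alpha> ` M)"
proof -
  have iso: "\<alpha> \<in> iso G G" and hm: "homeomorphic_map T T \<alpha>"
    using a by (auto simp: cont_Aut_def)
  then have hom: "\<alpha> \<in> hom G G" and bij: "bij_betw \<alpha> (carrier G) (carrier G)"
    by (auto simp: iso_def)
  interpret gh: group_hom G G \<alpha>
    by unfold_locales (use hom in auto)
  have inj: "inj_on \<alpha> (carrier G)" and surj: "\<alpha> ` carrier G = carrier G"
    using bij by (auto simp: bij_betw_def)
  have Msub: "subgroup M G" "openin T M" "M \<noteq> carrier G"
    and Mmax: "\<And>H. \<lbrakk>subgroup H G; openin T H; M \<subseteq> H\<rbrakk> \<Longrightarrow> H = M \<or> H = carrier G"
    using M by (auto simp: maximal_open_subgroup_def)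
  have Mc: "M \<subseteq> carrier G" using Msub(1) by (rule subgroup.subset)
  have 1: "subgroup (\<alpha> ` M) G" using Msub(1) by (rule gh.subgroup_img_is_subgroup)
  have 2: "openin T (\<alpha> ` M)"
    using homeomorphic_map_openness[OF hm, of M] Msub(2) Mc
    by (simp add: topspace_eq_carrier)
  have 3: "\<alpha> ` M \<noteq> carrier G"
    using inj surj Mc Msub(3) by (metis inj_on_image_eq_iff order_refl)
  have 4: "H = \<alpha> ` M \<or> H = carrier G"
    if H: "subgroup H G" "openin T H" "\<alpha> ` M \<subseteq> H" for H
  proof -
    let ?K = "{x \<in> carrier G. \<alpha> x \<in> H}"
    have Hc: "H \<subseteq> carrier G" using H(1) by (rule subgroup.subset)
    have im: "\<alpha> ` ?K = H" using surj Hc by auto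
    have "subgroup ?K G"
    proof (rule subgroup.intro)
      show "?K \<subseteq> carrier G" by auto
      show "\<one> \<in> ?K" using subgroup.one_closed[OF H(1)] by simp
      show "x \<otimes> y \<in> ?K" if "x \<in> ?K" "y \<in> ?K" for x y
        using that subgroup.m_closed[OF H(1)] by simp
      show "inv x \<in> ?K" if "x \<in> ?K" for x
        using that subgroup.m_inv_closed[OF H(1)] by simp
    qed
    moreover have "openin T ?K"
      using homeomorphic_map_openness[OF hm, of ?K] H(2) im by (auto simp: topspace_eq_carrier)
    moreover have "M \<subseteq> ?K" using H(3) Mc by auto
    ultimately have "?K = M \<or> ?K = carrier G" by (rule Mmax)
    then show ?thesis using im surj by auto
  qed
  show ?thesis using 1 2 3 4 by (auto simp: maximal_open_subgroup_def)
qed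

lemma (in topological_group) cont_Aut_inv:
  assumes a: "\<alpha> \<in> cont_Aut G T"
  shows "inv_into (carrier G) \<alpha> \<in> cont_Aut G T"
proof -
  have iso: "\<alpha> \<in> iso G G" and hm: "homeomorphic_map T T \<alpha>"
    using a by (auto simp: cont_Aut_def)
  let ?b = "inv_into (carrier G) \<alpha>"
  have bij: "bij_betw \<alpha> (carrier G) (carrier G)" using iso by (auto simp: iso_def)
  have "?b \<in> iso G G" using iso by (rule iso_set_sym)
  moreover have "homeomorphic_map T T ?b"
  proof -
    from hm obtain g where g: "homeomorphic_maps T T \<alpha> g"
      by (auto simp: homeomorphic_map_maps)
    have "g x = ?b x" if "x \<in> topspace T" for x
    proof -
      have "g x \<in> carrier G" "\<alpha> (g x) = x"
        using g that continuous_map_image_subset_topspace[of T T g]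
        by (auto simp: homeomorphic_maps_def topspace_eq_carrier)
      then show ?thesis using bij by (metis bij_betw_def inv_into_f_eq)
    qed
    moreover have "homeomorphic_map T T g"
      using g homeomorphic_maps_map by blast
    ultimately show ?thesis by (metis homeomorphic_map_eq)
  qed
  ultimately show ?thesis by (simp add: cont_Aut_def)
qed

lemma (in topological_group) image_Frattini:
  assumes a: "\<alpha> \<in> cont_Aut G T"
  shows "\<alpha> ` Frattini G T = Frattini G T"
proof -
  have sub: "\<beta> ` Frattini G T \<subseteq> Frattini G T" if b: "\<beta> \<in> cont_Aut G T" for \<beta>
  proof
    fix y assume "y \<in> \<beta> ` Frattini G T"
    then obtain x where x: "x \<in> Frattini G T" "y = \<beta> x" by auto
    have bij: "bij_betw \<beta> (carrier G) (carrier G)"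
      using b by (auto simp: cont_Aut_def iso_def)
    have xc: "x \<in> carrier G" using x by (auto simp: Frattini_def)
    have yc: "y \<in> carrier G" using xc x bij by (auto simp: bij_betw_def)
    let ?c = "inv_into (carrier G) \<beta>"
    have "y \<in> M" if M: "maximal_open_subgroup G T M" for M
    proof -
      have "x \<in> ?c ` M"
        using maximal_open_subgroup_image[OF cont_Aut_inv[OF b] M] x by (auto simp: Frattini_def)
      then obtain m where m: "m \<in> M" "x = ?c m" by auto
      have "m \<in> carrier G"
        using M m by (auto simp: maximal_open_subgroup_def dest: subgroup.mem_carrier)
      then have "\<beta> x = m" using m bij by (simp add: bij_betw_inv_into_right)
      then show ?thesis using x m by simp
    qed
    then show "y \<in> Frattini G T" using yc by (auto simp: Frattini_def)
  qed
  have bij: "bij_betw \<alpha> (carrier G) (carrier G)"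
    using a by (auto simp: cont_Aut_def iso_def)
  have "Frattini G T \<subseteq> \<alpha> ` Frattini G T"
  proof
    fix y assume y: "y \<in> Frattini G T"
    then have "inv_into (carrier G) \<alpha> y \<in> Frattini G T"
      using sub[OF cont_Aut_inv[OF a]] by auto
    moreover have "\<alpha> (inv_into (carrier G) \<alpha> y) = y"
      using y bij by (auto simp: Frattini_def bij_betw_inv_into_right)
    ultimately show "y \<in> \<alpha> ` Frattini G T" by (metis imageI)
  qed
  with sub[OF a] show ?thesis by auto
qed

lemma (in topological_group) image_Frattini_coset:
  assumes a: "\<alpha> \<in> cont_Aut G T" and g: "g \<in> carrier G"
  shows "\<alpha> ` (Frattini G T #> g) = Frattini G T #> \<alpha> g"
proof -
  have "\<alpha> (h \<otimes> g) = \<alpha> h \<otimes> \<alpha> g" if "h \<in> Frattini G T" for h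
    using a g that by (auto simp: cont_Aut_def iso_def hom_mult Frattini_def)
  then have "\<alpha> ` (Frattini G T #> g) = (\<alpha> ` Frattini G T) #> \<alpha> g"
    by (force simp: r_coset_def)
  then show ?thesis by (simp add: image_Frattini[OF a])
qed

end

theory Submission
  imports Defs "HOL-Algebra.Sylow" "HOL-Algebra.Group_Action" "HOL-Algebra.Zassenhaus"
begin

text \<open>
  Let \<open>V\<close> be the finite quotient of \<open>G\<close> by its Frattini subgroup \<open>\<Phi>\<close>. An endomorphism that is
  surjective on \<open>V\<close> is surjective by the Frattini argument, hence injective because finitely
  generated profinite groups are Hopfian. Suppose that \<open>\<phi>\<close> is not surjective on \<open>V\<close> and look at the
  semigroup of endomorphisms mapping \<open>Orb u\<close> into itself. If \<open>\<psi>\<close> in it has a kernel on \<open>V\<close> but does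
  not vanish on \<open>V\<close>, choose an automorphism \<open>\<alpha>\<close> moving a nonzero vector of the image of \<open>\<psi>\<close> into
  the kernel; then \<open>\<psi> \<circ> \<alpha> \<circ> \<psi>\<close> has a smaller image on \<open>V\<close>. So some \<open>\<psi>\<close> in the semigroup maps \<open>G\<close>
  into \<open>\<Phi>\<close>. For an open fully invariant \<open>K\<close>, the increasing chain of preimages of \<open>K\<close> under the
  powers of \<open>\<psi>\<close> stabilises at some \<open>A\<close>, on whose coset space \<open>\<psi>\<close> is injective, hence surjective;
  so \<open>A \<Phi> = G\<close> and \<open>A = G\<close>. Thus a power of \<open>\<psi>\<close> maps \<open>u\<close> into \<open>K\<close>, and as \<open>K\<close> is characteristic,
  \<open>u\<close> lies in \<open>K\<close>. These \<open>K\<close> intersect trivially, a contradiction.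
\<close>

section \<open>Actions of finite p-groups\<close>

text \<open>The inverse of \<open>f g\<close> is \<open>f (inv g)\<close>. The restriction to
  \<open>E\<close> is there because \<open>BijGroup E\<close> consists of extensional maps.\<close>

lemma (in group) group_actionI:
  assumes closed: "\<And>g x. \<lbrakk>g \<in> carrier G; x \<in> E\<rbrakk> \<Longrightarrow> f g x \<in> E"
    and one: "\<And>x. x \<in> E \<Longrightarrow> f \<one> x = x"
    and mult: "\<And>g h x. \<lbrakk>g \<in> carrier G; h \<in> carrier G; x \<in> E\<rbrakk> \<Longrightarrow> f (g \<otimes> h) x = f g (f h x)"
  shows "group_action G E (\<lambda>g. restrict (f g) E)"
proof -
  have Bij: "restrict (f g) E \<in> Bij E" if g: "g \<in> carrier G" for g
  proof -
    have "bij_betw (f g) E E"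
    proof (rule bij_betw_byWitness[where f' = "f (inv g)"])
      show "\<forall>x\<in>E. f (inv g) (f g x) = x" using g one mult[of "inv g" g] by auto
      show "\<forall>x\<in>E. f g (f (inv g) x) = x" using g one mult[of g "inv g"] by auto
    qed (use g closed in auto)
    then show ?thesis by (simp add: Bij_def)
  qed
  show ?thesis
    unfolding group_action_def
  proof (intro group_hom.intro group_hom_axioms.intro homI)
    show "group (BijGroup E)" by (rule group_BijGroup)
    fix g h assume gh: "g \<in> carrier G" "h \<in> carrier G"
    then show "restrict (f g) E \<in> carrier (BijGroup E)" using Bij by (simp add: BijGroup_def)
    show "restrict (f (g \<otimes> h)) E = restrict (f g) E \<otimes>\<^bsub>BijGroup E\<^esub> restrict (f h) E"
      using gh Bij mult closed by (auto simp: BijGroup_def compose_def restrict_def)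
  qed (rule is_group)
qed

text \<open>Orbit sizes divide \<open>p ^ k\<close>, so every orbit other than a fixed point has
  size divisible by \<open>p\<close>; hence so has the set of all moved points.\<close>

lemma (in group_action) p_group_fixed_points:
  assumes p: "prime p" and ord: "order G = p ^ k" and E: "finite E" "p dvd card E"
  shows "p dvd card {x \<in> E. \<forall>g\<in>carrier G. \<phi> g x = x}"
proof -
  \<comment> \<open>\<open>?f\<close> is the indicator of the moved points; summing it orbit by
    orbit counts them.\<close>
  let ?F = "{x \<in> E. \<forall>g\<in>carrier G. \<phi> g x = x}" and ?f = "\<lambda>x. if \<forall>g\<in>carrier G. \<phi> g x = x then 0 else 1 :: nat"
  interpret group_hom G "BijGroup E" \<phi> by (rule group_hom)
  interpret partition E "orbits G E \<phi>" by (rule orbit_partition)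
  have orb: "p dvd (\<Sum>x\<in>orbit G \<phi> x. ?f x)" if x: "x \<in> E" for x
  proof (cases "\<forall>g\<in>carrier G. \<phi> g x = x")
    case True
    then have "orbit G \<phi> x = {x}" using orbit_refl[OF x] by (auto simp: orbit_def)
    with True show ?thesis by simp
  next
    case False
    have sub: "orbit G \<phi> x \<subseteq> E" using x incl by (auto simp: orbits_def)
    then have fin: "finite (orbit G \<phi> x)" using E(1) finite_subset by blast
    have mem: "x \<in> orbit G \<phi> x" using x by (rule orbit_refl)
    have nfix: "\<exists>g\<in>carrier G. \<phi> g y \<noteq> y" if y: "y \<in> orbit G \<phi> x" for y
    proof (rule ccontr)
      assume "\<not> ?thesis"
      moreover have "y \<in> E" using y sub by auto
      moreover have "x \<in> orbit G \<phi> y" using orbit_sym x \<open>y \<in> E\<close> y by blast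
      ultimately have "x = y" by (auto simp: orbit_def)
      with \<open>\<not> ?thesis\<close> False show False by blast
    qed
    have "(\<Sum>x\<in>orbit G \<phi> x. ?f x) = (\<Sum>x\<in>orbit G \<phi> x. 1)"
      by (rule sum.cong) (use nfix in auto)
    then have 1: "(\<Sum>x\<in>orbit G \<phi> x. ?f x) = card (orbit G \<phi> x)" by simp
    have "card (orbit G \<phi> x) dvd p ^ k"
      using orbit_stabilizer_theorem[OF x] ord by (metis dvd_triv_left)
    then obtain i where i: "card (orbit G \<phi> x) = p ^ i"
      using divides_primepow_nat[OF p] by blast
    have "i \<noteq> 0"
    proof
      assume "i = 0"
      then obtain z where "orbit G \<phi> x = {z}" using i by (auto simp: card_1_singleton_iff)
      then have "orbit G \<phi> x = {x}" using mem by auto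
      with False show False by (auto simp: orbit_def)
    qed
    then show ?thesis using 1 i by simp
  qed
  have "(\<Sum>x\<in>E. ?f x) = (\<Sum>b\<in>orbits G E \<phi>. \<Sum>x\<in>b. ?f x)"
    by (rule disjoint_sum[OF E(1), symmetric])
  moreover have "p dvd (\<Sum>b\<in>orbits G E \<phi>. \<Sum>x\<in>b. ?f x)"
  proof (rule dvd_sum)
    fix b assume "b \<in> orbits G E \<phi>"
    then obtain x where x: "x \<in> E" "b = orbit G \<phi> x" unfolding orbits_def by blast
    show "p dvd (\<Sum>x\<in>b. ?f x)" unfolding x(2) by (rule orb[OF x(1)])
  qed
  ultimately have 1: "p dvd (\<Sum>x\<in>E. ?f x)" by (rule ssubst)
  have "(\<Sum>x\<in>E. ?f x) = card (E - ?F)"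
    using E(1) by (subst sum.mono_neutral_cong_right[where S = "E - ?F" and h = "\<lambda>_. 1"]) auto
  with 1 have 2: "p dvd card (E - ?F)" by (rule subst[rotated])
  have "card E = card (E - ?F) + card ?F"
    using E(1) by (subst card_Diff_subset) (auto simp: card_mono)
  with E(2) have "p dvd card (E - ?F) + card ?F" by (rule subst[rotated])
  with 2 show ?thesis by (simp only: dvd_add_right_iff)
qed

text \<open>\<open>M\<close> acts by right translation on its right cosets, whose number is a power
  of \<open>p\<close> other than 1. The number of fixed cosets is a multiple of \<open>p\<close> and
  \<open>M\<close> is one of them, so some other coset \<open>M g\<close> is fixed, which puts
  \<open>g M g^-1\<close> inside \<open>M\<close>.\<close>

lemma (in group) p_group_normalizer_grows:
  assumes p: "prime p" and ord: "order G = p ^ k"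
    and M: "subgroup M G" "M \<noteq> carrier G"
  shows "\<exists>g \<in> carrier G - M. \<forall>m\<in>M. g \<otimes> m \<otimes> inv g \<in> M"
proof -
  interpret M: subgroup M G by (rule M(1))
  have fin: "finite (carrier G)"
    using ord p order_gt_0_iff_finite prime_gt_0_nat by simp
  let ?H = "G\<lparr>carrier := M\<rparr>" and ?E = "rcosets M"
  interpret H: group ?H by (rule M.subgroup_is_group[OF is_group])
  have lag: "card ?E * card M = p ^ k" using lagrange[OF M(1)] ord by simp
  have finE: "finite ?E" using fin by (simp add: RCOSETS_def)
  obtain i where i: "card M = p ^ i" using lag divides_primepow_nat[OF p] by (metis dvd_triv_right)
  obtain j where j: "card ?E = p ^ j" using lag divides_primepow_nat[OF p] by (metis dvd_triv_left)
  have "card ?E \<noteq> 1"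
  proof
    assume "card ?E = 1"
    then have "card M = card (carrier G)" using lag ord by (simp add: order_def)
    then show False using M(2) fin M.subset by (simp add: card_subset_eq)
  qed
  then have dvd: "p dvd card ?E" using j by (cases j) auto
  \<comment> \<open>The inverse turns right translation into a left action.\<close>
  let ?f = "\<lambda>m X. X #> inv m"
  have "group_action ?H ?E (\<lambda>g. restrict (?f g) ?E)"
  proof (rule H.group_actionI)
    fix g X assume g: "g \<in> carrier ?H" and X: "X \<in> ?E"
    from X obtain x where x: "x \<in> carrier G" "X = M #> x" by (auto simp: RCOSETS_def)
    then show "X #> inv g \<in> ?E" using g by (auto simp: coset_mult_assoc M.subset intro!: rcosetsI)
  next
    fix X assume "X \<in> ?E"
    then obtain x where x: "x \<in> carrier G" "X = M #> x" by (auto simp: RCOSETS_def)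
    then show "X #> inv \<one>\<^bsub>?H\<^esub> = X" using x by (simp add: r_coset_subset_G M.subset)
  next
    fix g h X assume g: "g \<in> carrier ?H" and h: "h \<in> carrier ?H" and X: "X \<in> ?E"
    from X obtain x where x: "x \<in> carrier G" "X = M #> x" by (auto simp: RCOSETS_def)
    show "X #> inv (g \<otimes>\<^bsub>?H\<^esub> h) = X #> inv h #> inv g"
      using x g h by (simp add: inv_mult_group coset_mult_assoc M.subset r_coset_subset_G m_assoc)
  qed
  from group_action.p_group_fixed_points[OF this p _ finE dvd, of i]
  have "p dvd card {X \<in> ?E. \<forall>g\<in>M. X #> inv g = X}" (is "p dvd card ?F")
    using i by (simp add: order_def cong: conj_cong)
  moreover have MF: "M \<in> ?F"
    using M.subgroup_in_rcosets[OF is_group] coset_join2 M.m_inv_closed M.mem_carrier M(1) by auto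
  ultimately have "?F \<noteq> {M}" using p by (auto simp del: mem_Collect_eq)
  then obtain X where X: "X \<in> ?F" "X \<noteq> M" using MF by blast
  then obtain g where g: "g \<in> carrier G" "X = M #> g" by (auto simp: RCOSETS_def)
  have gM: "g \<notin> M" using X g coset_join2 M(1) by auto
  have "g \<otimes> m \<otimes> inv g \<in> M" if m: "m \<in> M" for m
  proof -
    have "M #> g #> inv (inv m) = M #> g" using X g m by blast
    then have "M #> (g \<otimes> m) = M #> g" using g m by (simp add: coset_mult_assoc M.subset)
    then have "g \<otimes> m \<in> M #> g"
      using g m by (metis M(1) M.mem_carrier m_closed rcos_self)
    then show ?thesis using g m by (simp add: M.rcos_module[OF is_group])
  qed
  with g gM show ?thesis by blast
qed

section \<open>Subgroups of bounded index\<close>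

text \<open>The function \<open>c\<close> labels the right cosets of \<open>H\<close>; labellings pull back along homomorphisms by
  composition.\<close>

definition (in group) index_le :: "'a set \<Rightarrow> nat \<Rightarrow> bool" where
  "index_le H n \<longleftrightarrow> (\<exists>c :: 'a \<Rightarrow> nat. c ` carrier G \<subseteq> {..<n} \<and>
     (\<forall>x\<in>carrier G. \<forall>y\<in>carrier G. c x = c y \<longleftrightarrow> x \<otimes> inv y \<in> H))"

lemma (in group) rcoset_eq_iff:
  assumes "subgroup H G" "x \<in> carrier G" "y \<in> carrier G"
  shows "H #> x = H #> y \<longleftrightarrow> x \<otimes> inv y \<in> H"
  using assms by (metis is_group rcos_self repr_independence subgroup.rcos_module)

lemma (in group) index_le_card_rcosets:
  assumes H: "subgroup H G" and fin: "finite (rcosets H)"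
  shows "index_le H (card (rcosets H))"
proof -
  obtain f :: "'a set \<Rightarrow> nat" where f: "bij_betw f (rcosets H) {..<card (rcosets H)}"
    using fin by (metis ex_bij_betw_finite_nat atLeast0LessThan)
  have mem: "H #> x \<in> rcosets H" if "x \<in> carrier G" for x
    using that by (auto simp: RCOSETS_def)
  have "f (H #> x) = f (H #> y) \<longleftrightarrow> x \<otimes> inv y \<in> H" if "x \<in> carrier G" "y \<in> carrier G" for x y
    using that f mem rcoset_eq_iff[OF H that] by (metis bij_betw_def inj_on_eq_iff)
  then show ?thesis
    unfolding index_le_def using f mem
    by (intro exI[of _ "\<lambda>x. f (H #> x)"]) (auto simp: bij_betw_def)
qed

lemma (in group) index_le_mono: "\<lbrakk>index_le H m; m \<le> n\<rbrakk> \<Longrightarrow> index_le H n"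
  unfolding index_le_def by (meson lessThan_subset_iff order_trans)

lemma (in group_hom) subgroup_vimage:
  assumes "subgroup K H"
  shows "subgroup {x \<in> carrier G. h x \<in> K} G"
proof (rule G.subgroupI)
  show "{x \<in> carrier G. h x \<in> K} \<noteq> {}"
    using subgroup.one_closed[OF assms] G.one_closed by force
qed (use assms in \<open>auto simp: subgroup.m_closed subgroup.m_inv_closed\<close>)

lemma (in group_hom) index_le_vimage:
  assumes "H.index_le K n"
  shows "G.index_le {x \<in> carrier G. h x \<in> K} n"
proof -
  from assms obtain c :: "'c \<Rightarrow> nat" where "c ` carrier H \<subseteq> {..<n}"
    "\<forall>x\<in>carrier H. \<forall>y\<in>carrier H. c x = c y \<longleftrightarrow> x \<otimes>\<^bsub>H\<^esub> inv\<^bsub>H\<^esub> y \<in> K"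
    by (auto simp: H.index_le_def)
  then show ?thesis
    unfolding G.index_le_def by (intro exI[of _ "c \<circ> h"]) (auto simp: image_subset_iff)
qed

text \<open>The Schreier graph of the cosets of \<open>H\<close>, labelled by \<open>c\<close> and restricted to generators,
  determines which generated elements lie in \<open>H\<close>.\<close>

lemma (in group) finite_index_le_generate:
  assumes S: "finite S" "S \<subseteq> carrier G"
  shows "finite ((\<lambda>H. H \<inter> generate G S) ` {H. subgroup H G \<and> index_le H n})"
proof -
  \<comment> \<open>Identity and inverses are included so that all base cases of
    \<open>generate\<close> are letters of \<open>S'\<close>.\<close>
  define S' where "S' = insert \<one> (S \<union> m_inv G ` S)"
  define label where "label H c \<longleftrightarrow> c ` carrier G \<subseteq> {..<n} \<and>
     (\<forall>x\<in>carrier G. \<forall>y\<in>carrier G. c x = c y \<longleftrightarrow> x \<otimes> inv y \<in> H)" for H and c :: "'a \<Rightarrow> nat"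
  \<comment> \<open>The relation that right multiplication by \<open>w\<close> induces on coset
    labels: the endpoints of the paths in the Schreier graph that spell \<open>w\<close>.\<close>
  define step where "step c w = {(c g, c (g \<otimes> w)) | g. g \<in> carrier G}" for c :: "'a \<Rightarrow> nat" and w
  \<comment> \<open>Base vertex and labelled edges. Labels are below \<open>n\<close> and
    \<open>S'\<close> is finite, so only finitely many values occur.\<close>
  define data where "data c = (c \<one>, {(s, e). s \<in> S' \<and> e \<in> step c s})" for c
  define C where "C H = (SOME c. label H c)" for H
  let ?A = "{H. subgroup H G \<and> index_le H n}"
  have C: "label H (C H)" if "H \<in> ?A" for H
    using that someI_ex[of "label H"] by (auto simp: C_def index_le_def label_def)
  have gen: "generate G S \<subseteq> carrier G" by (rule generate_incl[OF S(2)])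
  \<comment> \<open>Right multiplication respects right cosets, so a path arriving at the label
    \<open>c h\<close> may be continued from any representative.\<close>
  have comp: "step c (v \<otimes> w) = step c v O step c w"
    if H: "subgroup H G" and lab: "label H c" and vw: "v \<in> carrier G" "w \<in> carrier G" for H c v w
  proof (intro equalityI subsetI)
    fix e assume "e \<in> step c (v \<otimes> w)"
    then obtain g where "g \<in> carrier G" "e = (c g, c (g \<otimes> (v \<otimes> w)))" by (auto simp: step_def)
    then show "e \<in> step c v O step c w"
      using vw by (auto simp: step_def m_assoc[symmetric])
  next
    fix e assume "e \<in> step c v O step c w"
    then obtain g h where g: "g \<in> carrier G" "h \<in> carrier G" "c (g \<otimes> v) = c h"
      "e = (c g, c (h \<otimes> w))" by (auto simp: step_def)
    have "g \<otimes> v \<otimes> inv h \<in> H" using g vw lab by (auto simp: label_def)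
    moreover have "(g \<otimes> v \<otimes> w) \<otimes> inv (h \<otimes> w) = g \<otimes> v \<otimes> inv h"
      using g vw by (simp add: inv_mult_group m_assoc) (simp add: m_assoc[symmetric])
    ultimately have "c (g \<otimes> v \<otimes> w) = c (h \<otimes> w)"
      using g vw lab by (auto simp: label_def)
    then show "e \<in> step c (v \<otimes> w)" using g vw by (auto simp: step_def m_assoc)
  qed
  have determined: "H \<inter> generate G S = H' \<inter> generate G S"
    if H: "H \<in> ?A" "H' \<in> ?A" and eq: "data (C H) = data (C H')" for H H'
  proof -
    have gens: "step (C H) s = step (C H') s" if "s \<in> S'" for s
      using eq that by (auto simp: data_def)
    have step: "step (C H) w = step (C H') w" if "w \<in> generate G S" for w
      using that
    proof induction
      case (eng v w)
      then have vw: "v \<in> carrier G" "w \<in> carrier G" using gen by auto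
      have "subgroup H G" "subgroup H' G" using H by auto
      with vw eng.IH show ?case
        by (simp only: comp[OF _ C[OF H(1)]] comp[OF _ C[OF H(2)]])
    qed (auto intro!: gens simp: S'_def)
    \<comment> \<open>Membership in \<open>K\<close> is read off as a loop at the base vertex, the
      coset \<open>K\<close> itself.\<close>
    have iff: "w \<in> K \<longleftrightarrow> (C K \<one>, C K \<one>) \<in> step (C K) w"
      if K: "K \<in> ?A" and w: "w \<in> carrier G" for K w
    proof
      assume "w \<in> K"
      then have "C K w = C K \<one>" using C[OF K] w by (auto simp: label_def)
      then show "(C K \<one>, C K \<one>) \<in> step (C K) w" using w by (force simp: step_def)
    next
      assume "(C K \<one>, C K \<one>) \<in> step (C K) w"
      then obtain g where g: "g \<in> carrier G" "C K g = C K \<one>" "C K (g \<otimes> w) = C K \<one>"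
        by (auto simp: step_def)
      then have "g \<in> K" "g \<otimes> w \<in> K" using C[OF K] w by (auto simp: label_def)
      then have "inv g \<otimes> (g \<otimes> w) \<in> K"
        using K by (simp add: subgroup.m_closed subgroup.m_inv_closed)
      then show "w \<in> K" using g w by (simp add: m_assoc[symmetric])
    qed
    have "C H \<one> = C H' \<one>" using eq by (simp add: data_def)
    then show ?thesis using iff[OF H(1)] iff[OF H(2)] step gen by auto
  qed
  have "finite S'" using S by (simp add: S'_def)
  then have fin: "finite ({..<n} \<times> Pow (S' \<times> ({..<n} \<times> {..<n})))" by simp
  have S'c: "S' \<subseteq> carrier G" using S by (auto simp: S'_def)
  have "(\<lambda>H. data (C H)) ` ?A \<subseteq> {..<n} \<times> Pow (S' \<times> ({..<n} \<times> {..<n}))"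
  proof (intro image_subsetI)
    fix H assume "H \<in> ?A"
    then have lt: "C H x < n" if "x \<in> carrier G" for x using C that by (auto simp: label_def)
    have "g \<otimes> s \<in> carrier G" if "g \<in> carrier G" "s \<in> S'" for g s using S'c that by auto
    then show "data (C H) \<in> {..<n} \<times> Pow (S' \<times> ({..<n} \<times> {..<n}))"
      using lt by (auto simp: data_def step_def)
  qed
  then have "finite ((\<lambda>H. data (C H)) ` ?A)" using fin finite_subset by blast
  \<comment> \<open>One chosen subgroup for each value of the data already realises every trace on
    the generated subgroup.\<close>
  then have "finite ((\<lambda>d. inv_into ?A (\<lambda>H. data (C H)) d \<inter> generate G S) ` (\<lambda>H. data (C H)) ` ?A)"
    by (rule finite_imageI)
  moreover have "(\<lambda>H. H \<inter> generate G S) ` ?A \<subseteq>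
    (\<lambda>d. inv_into ?A (\<lambda>H. data (C H)) d \<inter> generate G S) ` (\<lambda>H. data (C H)) ` ?A"
  proof (rule image_subsetI)
    fix H assume H: "H \<in> ?A"
    let ?i = "inv_into ?A (\<lambda>H. data (C H)) (data (C H))"
    have im: "data (C H) \<in> (\<lambda>H. data (C H)) ` ?A" using H by (rule imageI)
    have "H \<inter> generate G S = ?i \<inter> generate G S"
      by (rule determined[OF H inv_into_into[OF im] f_inv_into_f[OF im, symmetric]])
    then show "H \<inter> generate G S \<in>
      (\<lambda>d. inv_into ?A (\<lambda>H. data (C H)) d \<inter> generate G S) ` (\<lambda>H. data (C H)) ` ?A"
      using im by (rule image_eqI)
  qed
  ultimately show ?thesis by (rule rev_finite_subset)
qed

section \<open>Topological groups\<close>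

context topological_group
begin

lemma continuous_map_mult_left: "g \<in> carrier G \<Longrightarrow> continuous_map T T (\<lambda>x. g \<otimes> x)"
  using continuous_map_compose[OF _ continuous_mult, of T "\<lambda>x. (g, x)"]
  by (simp add: o_def continuous_map_pairwise topspace_eq_carrier)

lemma continuous_map_mult_right: "g \<in> carrier G \<Longrightarrow> continuous_map T T (\<lambda>x. x \<otimes> g)"
  using continuous_map_compose[OF _ continuous_mult, of T "\<lambda>x. (x, g)"]
  by (simp add: o_def continuous_map_pairwise topspace_eq_carrier)

lemma cont_EndD:
  assumes "\<psi> \<in> cont_End G T"
  shows "group_hom G G \<psi>" "continuous_map T T \<psi>"
  using assms by (auto simp: cont_End_def group_hom_def group_hom_axioms_def)

lemma cont_End_compose:
  "\<lbrakk>\<psi> \<in> cont_End G T; \<rho> \<in> cont_End G T\<rbrakk> \<Longrightarrow> \<psi> \<circ> \<rho> \<in> cont_End G T"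
  by (auto simp: cont_End_def hom_def Pi_iff intro: continuous_map_compose)

lemma cont_End_funpow: "\<psi> \<in> cont_End G T \<Longrightarrow> \<psi> ^^ n \<in> cont_End G T"
proof (induction n)
  case 0
  then show ?case by (auto simp: cont_End_def hom_def)
next
  case (Suc n)
  then show ?case unfolding funpow.simps by (intro cont_End_compose)
qed

lemma cont_Aut_imp_cont_End: "\<alpha> \<in> cont_Aut G T \<Longrightarrow> \<alpha> \<in> cont_End G T"
  by (auto simp: cont_Aut_def cont_End_def iso_def homeomorphic_imp_continuous_map)

lemma conjugation_cont_End:
  assumes g: "g \<in> carrier G"
  shows "(\<lambda>x. g \<otimes> x \<otimes> inv g) \<in> cont_End G T"
proof -
  have "(\<lambda>x. g \<otimes> x \<otimes> inv g) \<in> hom G G"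
  proof (rule homI)
    fix x y assume "x \<in> carrier G" "y \<in> carrier G"
    moreover have "inv g \<otimes> (g \<otimes> z) = z" if "z \<in> carrier G" for z
      using g that by (simp add: m_assoc[symmetric])
    ultimately show "g \<otimes> (x \<otimes> y) \<otimes> inv g = (g \<otimes> x \<otimes> inv g) \<otimes> (g \<otimes> y \<otimes> inv g)"
      using g by (simp add: m_assoc)
  qed (use g in simp)
  moreover have "continuous_map T T (\<lambda>x. g \<otimes> x \<otimes> inv g)"
    using continuous_map_compose[OF continuous_map_mult_left continuous_map_mult_right] g
    by (force simp: o_def)
  ultimately show ?thesis by (simp add: cont_End_def)
qed

lemma conjugation_cont_Aut:
  assumes g: "g \<in> carrier G"
  shows "(\<lambda>x. g \<otimes> x \<otimes> inv g) \<in> cont_Aut G T"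
proof -
  let ?c = "\<lambda>g x. g \<otimes> x \<otimes> inv g"
  have c: "?c h \<in> cont_End G T" if "h \<in> carrier G" for h
    using that by (rule conjugation_cont_End)
  have inv1: "?c (inv g) (?c g x) = x" "?c g (?c (inv g) x) = x" if "x \<in> carrier G" for x
    using g that by (simp_all add: m_assoc) (simp_all add: m_assoc[symmetric])
  have "bij_betw (?c g) (carrier G) (carrier G)"
    by (rule bij_betw_byWitness[where f' = "?c (inv g)"]) (use g inv1 in auto)
  moreover have "homeomorphic_maps T T (?c g) (?c (inv g))"
    unfolding homeomorphic_maps_def topspace_eq_carrier
    using c[of g] c[of "inv g"] g inv1 by (auto simp: cont_End_def)
  ultimately show ?thesis
    using c[OF g] by (auto simp: cont_Aut_def cont_End_def iso_def homeomorphic_map_maps)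
qed

lemma openin_rcoset:
  assumes U: "openin T U" and g: "g \<in> carrier G"
  shows "openin T (U #> g)"
proof -
  have "U \<subseteq> carrier G" using U openin_subset topspace_eq_carrier by blast
  then have "U #> g = {x \<in> topspace T. x \<otimes> inv g \<in> U}"
    using g by (force simp: r_coset_def topspace_eq_carrier m_assoc)
  then show ?thesis
    using openin_continuous_map_preimage[OF continuous_map_mult_right U, of "inv g"] g by simp
qed

text \<open>\<open>H\<close> is the union of the open translates \<open>U #> h\<close> with
  \<open>h\<close> in \<open>H\<close>.\<close>

lemma openin_subgroup_mono:
  assumes H: "subgroup H G" and U: "openin T U" "\<one> \<in> U" "U \<subseteq> H"
  shows "openin T H"
proof (subst openin_subopen, intro ballI)
  fix h assume h: "h \<in> H"
  then have hc: "h \<in> carrier G" using subgroup.mem_carrier[OF H] by simp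
  have "U #> h \<subseteq> H" using U h H by (auto simp: r_coset_def subgroup.m_closed)
  moreover have "h \<in> U #> h" using U hc by (force simp: r_coset_def)
  ultimately show "\<exists>V. openin T V \<and> h \<in> V \<and> V \<subseteq> H" using openin_rcoset[OF U(1) hc] by blast
qed

lemma openin_supergroup:
  "\<lbrakk>subgroup H G; subgroup K G; openin T K; K \<subseteq> H\<rbrakk> \<Longrightarrow> openin T H"
  using openin_subgroup_mono subgroup.one_closed by blast

text \<open>The complement is a union of right cosets, each of which is open.\<close>

lemma closedin_open_subgroup:
  assumes H: "subgroup H G" and op: "openin T H"
  shows "closedin T H"
proof -
  have "carrier G - H = (\<Union>g\<in>carrier G - H. H #> g)"
  proof (intro equalityI subsetI)
    fix x assume "x \<in> carrier G - H"
    then show "x \<in> (\<Union>g\<in>carrier G - H. H #> g)" using rcos_self[OF _ H] by blast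
  next
    fix x assume "x \<in> (\<Union>g\<in>carrier G - H. H #> g)"
    then obtain g where g: "g \<in> carrier G" "g \<notin> H" "x \<in> H #> g" by blast
    then have x: "x \<in> carrier G" using H by (meson subgroup.elemrcos_carrier is_group)
    have "x \<notin> H"
    proof
      assume "x \<in> H"
      obtain h where "h \<in> H" "x = h \<otimes> g" using g by (auto simp: r_coset_def)
      then have "inv h \<otimes> x = g"
        using g H subgroup.mem_carrier[OF H] by (simp add: m_assoc[symmetric])
      then show False
        using \<open>x \<in> H\<close> \<open>h \<in> H\<close> g H by (metis subgroup.m_closed subgroup.m_inv_closed)
    qed
    with x show "x \<in> carrier G - H" by blast
  qed
  moreover have "openin T (\<Union>g\<in>carrier G - H. H #> g)"
    using openin_rcoset[OF op] by blast
  ultimately show ?thesis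
    using H by (simp add: closedin_def topspace_eq_carrier subgroup.subset)
qed

lemma openin_vimage:
  assumes "\<psi> \<in> cont_End G T" "openin T U"
  shows "openin T {x \<in> carrier G. \<psi> x \<in> U}"
  using openin_continuous_map_preimage[OF cont_EndD(2)[OF assms(1)] assms(2)]
  by (simp add: topspace_eq_carrier)

section \<open>Intersections of open subgroups of bounded index\<close>

text \<open>This supplies the fully invariant subgroups \<open>K\<close>; for finitely generated
  \<open>G\<close> they are open. Intersecting with the carrier makes the value
  \<open>carrier G\<close> for \<open>n = 0\<close>, when no subgroup qualifies.\<close>

definition index_core :: "nat \<Rightarrow> 'a set" where
  "index_core n = carrier G \<inter> \<Inter> {H. subgroup H G \<and> openin T H \<and> index_le H n}"

lemma index_core_subset: "\<lbrakk>subgroup H G; openin T H; index_le H n\<rbrakk> \<Longrightarrow> index_core n \<subseteq> H"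
  by (auto simp: index_core_def)

lemma index_core_subgroup: "subgroup (index_core n) G"
proof (rule subgroup.intro)
qed (auto simp: index_core_def subgroup.m_closed subgroup.one_closed subgroup.m_inv_closed)

text \<open>Preimages under a continuous endomorphism are again open of index at most
  \<open>n\<close>, so they belong to the family being intersected.\<close>

lemma index_core_invariant:
  assumes \<psi>: "\<psi> \<in> cont_End G T" and x: "x \<in> index_core n"
  shows "\<psi> x \<in> index_core n"
proof -
  interpret h: group_hom G G \<psi> by (rule cont_EndD(1)[OF \<psi>])
  have xc: "x \<in> carrier G" using x by (simp add: index_core_def)
  have "\<psi> x \<in> H" if H: "subgroup H G" "openin T H" "index_le H n" for H
    using index_core_subset[OF h.subgroup_vimage[OF H(1)] openin_vimage[OF \<psi> H(2)]
        h.index_le_vimage[OF H(3)]] x by blast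
  then show ?thesis using xc by (auto simp: index_core_def)
qed

lemma index_core_normal: "index_core n \<lhd> G"
  unfolding normal_inv_iff
  using index_core_subgroup index_core_invariant[OF conjugation_cont_End] by simp

lemma Frattini_subgroup: "subgroup (Frattini G T) G"
  by (rule subgroup.intro)
    (auto simp: Frattini_def maximal_open_subgroup_def subgroup.m_closed subgroup.one_closed
      subgroup.m_inv_closed)

lemma Frattini_normal: "Frattini G T \<lhd> G"
  unfolding normal_inv_iff
  using Frattini_subgroup image_Frattini[OF conjugation_cont_Aut] by blast

end

section \<open>Profinite groups\<close>

text \<open>\<open>c\<close> labels the classes of \<open>X\<close>, and \<open>f\<close> descends
  to a self-map \<open>F\<close> of the finite set of labels, for which injectivity and surjectivity
  agree. The choice of representatives in \<open>F\<close> is harmless by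
  \<open>cong\<close>.\<close>

lemma finite_quotient_inj_iff_surj:
  assumes fin: "finite (c ` X)" and closed: "f ` X \<subseteq> X"
    and cong: "\<And>x y. \<lbrakk>x \<in> X; y \<in> X; c x = c y\<rbrakk> \<Longrightarrow> c (f x) = c (f y)"
  shows "(\<forall>x\<in>X. \<forall>y\<in>X. c (f x) = c (f y) \<longrightarrow> c x = c y) \<longleftrightarrow> (\<forall>y\<in>X. \<exists>x\<in>X. c (f x) = c y)"
    (is "?inj \<longleftrightarrow> ?surj")
proof -
  define F where "F i = c (f (inv_into X c i))" for i
  have F: "F (c x) = c (f x)" if "x \<in> X" for x
    unfolding F_def using that by (intro cong) (auto intro: inv_into_into f_inv_into_f)
  have "inj_on F (c ` X) \<longleftrightarrow> F ` c ` X = c ` X"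
  proof
    show "inj_on F (c ` X) \<Longrightarrow> F ` c ` X = c ` X"
      using F closed by (intro endo_inj_surj[OF fin]) auto
    show "F ` c ` X = c ` X \<Longrightarrow> inj_on F (c ` X)"
      by (intro finite_surj_inj[OF fin]) simp
  qed
  moreover have "inj_on F (c ` X) \<longleftrightarrow> ?inj"
    using F by (auto simp: inj_on_def)
  moreover have "F ` c ` X = c ` X \<longleftrightarrow> ?surj"
  proof -
    have "F ` c ` X = (\<lambda>x. c (f x)) ` X" using F by (simp add: image_image)
    moreover have "\<dots> \<subseteq> c ` X" using closed by auto
    moreover have "c ` X \<subseteq> (\<lambda>x. c (f x)) ` X \<longleftrightarrow> ?surj"
      by (auto simp: image_iff eq_commute)
    ultimately show ?thesis by auto
  qed
  ultimately show ?thesis by simp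
qed

text \<open>This concerns the self-map \<open>A x -> A h(x)\<close> of a finite coset space: the
  left side is injectivity tested at the trivial coset, the right side surjectivity. Cosets replace
  a quotient group because the lemma is also applied to a maximal subgroup before it is known to be
  normal.\<close>

lemma (in group) finite_index_inj_iff_surj:
  assumes A: "subgroup A G" "finite (rcosets A)" and h: "group_hom G G h"
    and inv: "\<And>x. x \<in> A \<Longrightarrow> h x \<in> A"
  shows "(\<forall>x\<in>carrier G. h x \<in> A \<longrightarrow> x \<in> A) \<longleftrightarrow>
    (\<forall>g\<in>carrier G. \<exists>x\<in>carrier G. h x \<otimes> inv g \<in> A)"
proof -
  interpret h: group_hom G G h by (rule h)
  let ?c = "\<lambda>x. A #> x"
  have eq: "?c x = ?c y \<longleftrightarrow> x \<otimes> inv y \<in> A" if "x \<in> carrier G" "y \<in> carrier G" for x y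
    using rcoset_eq_iff[OF A(1) that] .
  have img: "h x \<otimes> inv h y = h (x \<otimes> inv y)" if "x \<in> carrier G" "y \<in> carrier G" for x y
    using that by simp
  have "?c ` carrier G = rcosets A" by (auto simp: RCOSETS_def)
  then have fin: "finite (?c ` carrier G)" using A(2) by simp
  have "(\<forall>x\<in>carrier G. \<forall>y\<in>carrier G. ?c (h x) = ?c (h y) \<longrightarrow> ?c x = ?c y) \<longleftrightarrow>
    (\<forall>y\<in>carrier G. \<exists>x\<in>carrier G. ?c (h x) = ?c y)"
  proof (rule finite_quotient_inj_iff_surj[OF fin])
    fix x y assume xy: "x \<in> carrier G" "y \<in> carrier G" "?c x = ?c y"
    then have "x \<otimes> inv y \<in> A" using eq by blast
    then have "h (x \<otimes> inv y) \<in> A" by (rule inv)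
    with xy show "?c (h x) = ?c (h y)" by (simp add: eq)
  qed auto
  moreover have "(\<forall>x\<in>carrier G. \<forall>y\<in>carrier G. ?c (h x) = ?c (h y) \<longrightarrow> ?c x = ?c y) \<longleftrightarrow>
    (\<forall>x\<in>carrier G. h x \<in> A \<longrightarrow> x \<in> A)" (is "?l \<longleftrightarrow> ?r")
  proof
    assume l: ?l
    show ?r
    proof (intro ballI impI)
      fix x assume x: "x \<in> carrier G" "h x \<in> A"
      then have "?c (h x) = ?c (h \<one>)" by (simp add: eq)
      then have "?c x = ?c \<one>" using l x by blast
      then show "x \<in> A" using x eq[of x \<one>] by simp
    qed
  next
    assume r: ?r
    show ?l
    proof (intro ballI impI)
      fix x y assume xy: "x \<in> carrier G" "y \<in> carrier G" "?c (h x) = ?c (h y)"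
      then have "h (x \<otimes> inv y) \<in> A" by (simp add: eq)
      moreover have "x \<otimes> inv y \<in> carrier G" using xy by simp
      ultimately have "x \<otimes> inv y \<in> A" using r by blast
      then show "?c x = ?c y" using eq xy by blast
    qed
  qed
  ultimately show ?thesis by (simp add: eq)
qed

text \<open>Each such \<open>H\<close> is a union of cosets of \<open>A\<close>.\<close>

lemma (in group) finite_supergroups:
  assumes A: "subgroup A G" "finite (rcosets A)"
  shows "finite {H. subgroup H G \<and> A \<subseteq> H}"
proof (rule finite_subset)
  show "{H. subgroup H G \<and> A \<subseteq> H} \<subseteq> Union ` Pow (rcosets A)"
  proof
    fix H assume "H \<in> {H. subgroup H G \<and> A \<subseteq> H}"
    then have H: "subgroup H G" "A \<subseteq> H" by auto
    have "A #> h \<subseteq> H" if "h \<in> H" for h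
      using H that by (auto simp: r_coset_def subgroup.m_closed)
    moreover have "h \<in> A #> h" if "h \<in> H" for h
      by (rule rcos_self[OF subgroup.mem_carrier[OF H(1) that] A(1)])
    ultimately have "H = \<Union>((\<lambda>h. A #> h) ` H)" by blast
    moreover have "(\<lambda>h. A #> h) ` H \<in> Pow (rcosets A)"
      using subgroup.mem_carrier[OF H(1)] by (auto simp: RCOSETS_def)
    ultimately show "H \<in> Union ` Pow (rcosets A)" by (rule image_eqI)
  qed
qed (use A(2) in simp)

context profinite_group
begin

section \<open>Separation of points by open subgroups\<close>

text \<open>In a compact Hausdorff space components coincide with quasi-components, and here
  components are points.\<close>

lemma clopen_separation:
  assumes "x \<in> carrier G" "y \<in> carrier G" "x \<noteq> y"
  shows "\<exists>U. openin T U \<and> closedin T U \<and> x \<in> U \<and> y \<notin> U"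
proof -
  have "connectedin T {z. connected_component_of T x z}"
    by (rule connectedin_connected_component_of)
  then have "\<not> connected_component_of T x y"
    using totally_disconnected[of "{z. connected_component_of T x z}" x y] assms
    by (auto simp: connected_component_of_refl topspace_eq_carrier)
  moreover have "quasi_component_of T x = connected_component_of T x"
    by (rule quasi_eq_connected_component_of) (simp add: compact Hausdorff)
  ultimately have "\<not> quasi_component_of T x y" by simp
  then show ?thesis using assms by (auto simp: quasi_component_of topspace_eq_carrier)
qed

text \<open>A tube-lemma argument: the complement is the projection of the closed set of pairs
  \<open>(v, x)\<close> with \<open>v\<close> in \<open>U\<close> and \<open>v x\<close> outside
  \<open>U\<close>, and projection along a compact factor is a closed map.\<close>

lemma openin_right_stabilizer:
  assumes U: "openin T U" "closedin T U"
  shows "openin T {x \<in> carrier G. \<forall>v\<in>U. v \<otimes> x \<in> U}"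
proof -
  let ?P = "prod_topology T T"
  let ?C = "{z \<in> topspace ?P. fst z \<in> U \<and> (\<lambda>(x, y). x \<otimes> y) z \<in> topspace T - U}"
  have "closedin T (topspace T - U)" using U(1) by blast
  then have "closedin ?P ({z \<in> topspace ?P. fst z \<in> U} \<inter>
      {z \<in> topspace ?P. (\<lambda>(x, y). x \<otimes> y) z \<in> topspace T - U})"
    by (intro closedin_Int closedin_continuous_map_preimage[OF continuous_map_fst U(2)]
        closedin_continuous_map_preimage[OF continuous_mult])
  moreover have "\<dots> = ?C" by auto
  ultimately have "closedin ?P ?C" by simp
  then have "closedin T (snd ` ?C)"
    using Abstract_Topological_Spaces.closed_map_snd[OF compact, of T] by (simp add: closed_map_def)
  moreover have "{x \<in> carrier G. \<forall>v\<in>U. v \<otimes> x \<in> U} = topspace T - snd ` ?C"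
    using closedin_subset[OF U(2)] by (force simp: topspace_eq_carrier image_iff)
  ultimately show ?thesis by auto
qed

text \<open>For a clopen \<open>U\<close> containing \<one> but not \<open>g\<close>, the
  \<open>x\<close> with \<open>U x\<close> inside \<open>U\<close> form an open submonoid, which
  lies in \<open>U\<close> because \<one> does. The elements lying in it together with their
  inverses form the subgroup.\<close>

lemma open_subgroup_separation:
  assumes g: "g \<in> carrier G" "g \<noteq> \<one>"
  shows "\<exists>H. subgroup H G \<and> openin T H \<and> g \<notin> H"
proof -
  obtain U where U: "openin T U" "closedin T U" "\<one> \<in> U" "g \<notin> U"
    using clopen_separation[of \<one> g] g by auto
  let ?O = "{x \<in> carrier G. \<forall>v\<in>U. v \<otimes> x \<in> U}"
  have Uc: "v \<in> carrier G" if "v \<in> U" for v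
    using that closedin_subset[OF U(2)] topspace_eq_carrier by auto
  let ?H = "?O \<inter> {x \<in> topspace T. inv x \<in> ?O}"
  have "openin T ?O" by (rule openin_right_stabilizer[OF U(1,2)])
  then have "openin T ?H"
    by (intro openin_Int openin_continuous_map_preimage[OF continuous_inv])
  moreover have "subgroup ?H G"
    by (rule subgroup.intro)
      (use Uc in \<open>auto simp: topspace_eq_carrier inv_mult_group m_assoc[symmetric]\<close>)
  moreover have "g \<notin> ?H"
  proof
    assume "g \<in> ?H"
    then have "\<one> \<otimes> g \<in> U" using U(3) by blast
    then show False using U(4) g by simp
  qed
  ultimately show ?thesis by blast
qed

text \<open>The right cosets are a disjoint open cover, so a finite subcover cannot omit any of
  them.\<close>

lemma finite_rcosets_open:
  assumes H: "subgroup H G" and op: "openin T H"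
  shows "finite (rcosets H)"
proof -
  have "compactin T (topspace T)" using compact by (simp add: compact_space_def)
  moreover have "\<forall>X \<in> rcosets H. openin T X"
    using openin_rcoset[OF op] by (auto simp: RCOSETS_def)
  moreover have un: "\<Union>(rcosets H) = topspace T"
    using rcosets_part_G[OF H] by (simp add: topspace_eq_carrier)
  ultimately obtain F where F: "finite F" "F \<subseteq> rcosets H" "topspace T \<subseteq> \<Union>F"
    unfolding compactin_def by (metis order_refl)
  have "rcosets H \<subseteq> F"
  proof
    fix X assume X: "X \<in> rcosets H"
    then obtain x where x: "x \<in> X" using subgroup.rcosets_non_empty[OF H] by blast
    then obtain Y where Y: "Y \<in> F" "x \<in> Y" using F(3) un X by blast
    then have "X = Y" using rcos_disjoint[OF H] X x F(2) by (auto simp: pairwise_def disjnt_def)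
    then show "X \<in> F" using Y by simp
  qed
  then show ?thesis using F finite_subset by blast
qed

section \<open>Maximal open subgroups and the Frattini argument\<close>

text \<open>Finite index leaves finitely many subgroups above \<open>A\<close>, so a maximal proper
  one exists; all of them are open because \<open>A\<close> is.\<close>

lemma maximal_open_subgroup_above:
  assumes A: "subgroup A G" "openin T A" "A \<noteq> carrier G"
  shows "\<exists>M. maximal_open_subgroup G T M \<and> A \<subseteq> M"
proof -
  let ?S = "{H. subgroup H G \<and> A \<subseteq> H \<and> H \<noteq> carrier G}"
  have fin: "finite ?S"
    by (rule finite_subset[OF _ finite_supergroups[OF A(1) finite_rcosets_open[OF A(1,2)]]]) auto
  have "A \<in> ?S" using A by simp
  from finite_has_maximal2[OF fin this]
  obtain M where M: "M \<in> ?S" "\<forall>H\<in>?S. M \<subseteq> H \<longrightarrow> M = H" by blast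
  then have "maximal_open_subgroup G T M"
    using openin_supergroup[OF _ A(1,2)] by (auto simp: maximal_open_subgroup_def)
  with M show ?thesis by blast
qed

text \<open>The Frattini argument: a proper \<open>A\<close> would lie in a maximal open subgroup,
  which also contains the Frattini subgroup and hence everything.\<close>

lemma eq_carrier_if_supplements_Frattini:
  assumes A: "subgroup A G" "openin T A"
    and gen: "\<And>g. g \<in> carrier G \<Longrightarrow> \<exists>a\<in>A. a \<otimes> inv g \<in> Frattini G T"
  shows "A = carrier G"
proof (rule ccontr)
  assume "A \<noteq> carrier G"
  then obtain M where M: "maximal_open_subgroup G T M" "A \<subseteq> M"
    using maximal_open_subgroup_above A by blast
  have Ms: "subgroup M G" "M \<noteq> carrier G" using M by (auto simp: maximal_open_subgroup_def)
  interpret M: subgroup M G by (rule Ms)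
  have "g \<in> M" if g: "g \<in> carrier G" for g
  proof -
    obtain a where a: "a \<in> A" "a \<otimes> inv g \<in> Frattini G T" using gen[OF g] by blast
    then have am: "a \<in> M" "a \<otimes> inv g \<in> M" using M by (auto simp: Frattini_def)
    then have "inv (a \<otimes> inv g) \<otimes> a \<in> M" by blast
    then show ?thesis using g am(1) by (simp add: inv_mult_group m_assoc)
  qed
  then show False using Ms M.subset by blast
qed

lemma exists_index_core_subset_open_subgroup:
  assumes "subgroup H G" "openin T H"
  shows "\<exists>n. index_core n \<subseteq> H"
  using index_core_subset[OF assms index_le_card_rcosets[OF assms(1) finite_rcosets_open[OF assms]]]
  by blast

lemma exists_index_core_notin:
  "\<lbrakk>g \<in> carrier G; g \<noteq> \<one>\<rbrakk> \<Longrightarrow> \<exists>n. g \<notin> index_core n"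
  by (meson exists_index_core_subset_open_subgroup open_subgroup_separation subsetD)

text \<open>An open subgroup is closed, so it is the closure of its trace on the dense subgroup
  \<open>generate G S\<close>. There are finitely many traces, so the core is a finite intersection
  of open subgroups.\<close>

lemma openin_index_core:
  assumes fg: "top_finitely_generated G T"
  shows "openin T (index_core n)"
proof -
  obtain S where S: "finite S" "S \<subseteq> carrier G" "T closure_of (generate G S) = carrier G"
    using fg by (auto simp: top_finitely_generated_def)
  let ?F = "{H. subgroup H G \<and> openin T H \<and> index_le H n}"
  have closure: "H = T closure_of (H \<inter> generate G S)" if "subgroup H G" "openin T H" for H
  proof -
    have "T closure_of (H \<inter> generate G S) = T closure_of (H \<inter> T closure_of (generate G S))"
      using that(2) by (simp add: closure_of_openin_Int_closure_of)
    also have "H \<inter> T closure_of (generate G S) = H"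
      using S(3) subgroup.subset[OF that(1)] by blast
    also have "T closure_of H = H"
      using closedin_open_subgroup[OF that] by (simp add: closure_of_closedin)
    finally show ?thesis by simp
  qed
  then have "inj_on (\<lambda>H. H \<inter> generate G S) ?F" by (auto intro!: inj_onI) metis+
  moreover have "finite ((\<lambda>H. H \<inter> generate G S) ` ?F)"
    by (rule finite_subset[OF _ finite_index_le_generate[OF S(1,2), of n]]) auto
  ultimately have "finite ?F" using finite_imageD by blast
  \<comment> \<open>Inserting the whole space keeps the family nonempty, which matters for
    \<open>n = 0\<close>.\<close>
  then have "openin T (\<Inter>(insert (topspace T) ?F))" by (intro openin_Inter) auto
  moreover have "\<Inter>(insert (topspace T) ?F) = index_core n"
    by (simp add: index_core_def topspace_eq_carrier)
  ultimately show ?thesis by (simp only:)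
qed

end

section \<open>Pro-p groups\<close>

text \<open>\<open>g\<close> is \<open>h\<close> after \<open>f\<close>, and \<open>h\<close>
  identifies two points of the finite image of \<open>f\<close>. This gives the decreasing measure
  of the descent.\<close>

lemma card_image_less_if_factors:
  assumes fin: "finite (f ` X)"
    and factors: "\<And>x y. \<lbrakk>x \<in> X; y \<in> X; f x = f y\<rbrakk> \<Longrightarrow> g x = g y"
    and xy: "x \<in> X" "y \<in> X" "g x = g y" "f x \<noteq> f y"
  shows "card (g ` X) < card (f ` X)"
proof -
  define h where "h i = g (inv_into X f i)" for i
  have h: "h (f z) = g z" if "z \<in> X" for z
    unfolding h_def using that by (intro factors) (auto intro: inv_into_into f_inv_into_f)
  then have img: "g ` X = h ` f ` X" by (auto simp: image_image)
  have "\<not> inj_on h (f ` X)" using xy h by (auto simp: inj_on_def)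
  then have "card (h ` f ` X) \<noteq> card (f ` X)" using eq_card_imp_inj_on[OF fin] by blast
  with card_image_le[OF fin, of h] show ?thesis by (simp add: img)
qed

lemma (in topological_group) maximal_open_subgroupD:
  assumes M: "maximal_open_subgroup G T M" and H: "subgroup H G" "M \<subseteq> H"
  shows "H = M \<or> H = carrier G"
proof -
  have "subgroup M G" "openin T M" using M by (auto simp: maximal_open_subgroup_def)
  then have "openin T H" using openin_supergroup H by blast
  then show ?thesis using M H by (auto simp: maximal_open_subgroup_def)
qed

context pro_p_group
begin

section \<open>Normality and index of maximal open subgroups\<close>

text \<open>Some \<open>index_core n\<close> lies inside \<open>M\<close>, so the question passes to
  a finite \<open>p\<close>-group, where normalizers grow. The normalizer of \<open>M\<close> is
  then larger than \<open>M\<close>, and maximality makes it all of \<open>G\<close>.\<close>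

lemma maximal_open_subgroup_normal:
  assumes fg: "top_finitely_generated G T" and M: "maximal_open_subgroup G T M"
  shows "M \<lhd> G"
proof -
  have Ms: "subgroup M G" "openin T M" "M \<noteq> carrier G" using M by (auto simp: maximal_open_subgroup_def)
  interpret M: subgroup M G by (rule Ms)
  obtain n where n: "index_core n \<subseteq> M"
    using exists_index_core_subset_open_subgroup[OF Ms(1,2)] by blast
  let ?K = "index_core n"
  interpret K: normal ?K G by (rule index_core_normal)
  let ?Q = "G Mod ?K" and ?q = "\<lambda>x. ?K #> x"
  interpret Q: group ?Q by (rule K.factorgroup_is_group)
  interpret q: group_hom G ?Q ?q
    by (intro group_hom.intro group_hom_axioms.intro is_group Q.is_group K.r_coset_hom_Mod)
  obtain k where k: "order ?Q = p ^ k"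
    using open_normal_index[OF index_core_normal openin_index_core[OF fg]] by blast
  \<comment> \<open>As \<open>?K\<close> is contained in \<open>M\<close>, membership in
    \<open>M\<close> can be tested in the quotient.\<close>
  have mem: "?q x \<in> ?q ` M \<longleftrightarrow> x \<in> M" if x: "x \<in> carrier G" for x
  proof
    assume "?q x \<in> ?q ` M"
    then obtain m where m: "m \<in> M" "?q x = ?q m" by blast
    then have "x \<otimes> inv m \<in> M"
      using n rcoset_eq_iff[OF index_core_subgroup x M.mem_carrier] by blast
    then have "x \<otimes> inv m \<otimes> m \<in> M" using m by blast
    then show "x \<in> M" using x m by (simp add: m_assoc)
  qed blast
  have sub: "subgroup (?q ` M) ?Q" by (rule q.subgroup_img_is_subgroup[OF Ms(1)])
  have ne: "?q ` M \<noteq> carrier ?Q"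
  proof
    assume eq: "?q ` M = carrier ?Q"
    have "x \<in> M" if "x \<in> carrier G" for x
      using mem[OF that] q.hom_closed[OF that] eq by simp
    then show False using Ms(3) M.subset by blast
  qed
  from Q.p_group_normalizer_grows[OF prime_p k sub ne]
  obtain g' where g': "g' \<in> carrier ?Q - ?q ` M"
      "\<forall>m\<in>?q ` M. g' \<otimes>\<^bsub>?Q\<^esub> m \<otimes>\<^bsub>?Q\<^esub> inv\<^bsub>?Q\<^esub> g' \<in> ?q ` M"
    by (rule bexE)
  from g'(1) obtain g where g: "g \<in> carrier G" "g' = ?q g" by (auto simp: carrier_FactGroup)
  have gM: "g \<notin> M" using g g'(1) mem by blast
  let ?c = "\<lambda>x. g \<otimes> x \<otimes> inv g"
  have c: "?c m \<in> M" if m: "m \<in> M" for m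
  proof -
    have "?q (?c m) = ?q g \<otimes>\<^bsub>?Q\<^esub> ?q m \<otimes>\<^bsub>?Q\<^esub> inv\<^bsub>?Q\<^esub> (?q g)"
      using g m by (simp only: q.hom_mult q.hom_inv M.mem_carrier m_closed inv_closed)
    then have "?q (?c m) \<in> ?q ` M" using g'(2) g(2) m by simp
    moreover have "?c m \<in> carrier G" using g(1) m by simp
    ultimately show ?thesis using mem by blast
  qed
  \<comment> \<open>Conjugation by \<open>g\<close> maps \<open>M\<close> into itself and is onto,
    so it is also injective on the finite coset space of \<open>M\<close>; this gives the converse
    inclusion.\<close>
  have "\<exists>x\<in>carrier G. ?c x \<otimes> inv y \<in> M" if y: "y \<in> carrier G" for y
  proof (intro bexI)
    have "?c (inv g \<otimes> y \<otimes> g) = y"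
      using g y by (simp add: m_assoc) (simp add: m_assoc[symmetric])
    then show "?c (inv g \<otimes> y \<otimes> g) \<otimes> inv y \<in> M" using y by simp
  qed (use g y in simp)
  then have c': "x \<in> M" if "x \<in> carrier G" "?c x \<in> M" for x
    using finite_index_inj_iff_surj[OF Ms(1) finite_rcosets_open[OF Ms(1,2)]
        cont_EndD(1)[OF conjugation_cont_End[OF g(1)]] c] that by blast
  \<comment> \<open>The normalizer of \<open>M\<close>, written with an equivalence so that it is
    closed under inverses.\<close>
  let ?L = "{x \<in> carrier G. \<forall>y\<in>carrier G. x \<otimes> y \<otimes> inv x \<in> M \<longleftrightarrow> y \<in> M}"
  have L: "subgroup ?L G"
  proof (rule subgroup.intro)
    fix x z assume x: "x \<in> ?L" and z: "z \<in> ?L"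
    have "(x \<otimes> z) \<otimes> y \<otimes> inv (x \<otimes> z) = x \<otimes> (z \<otimes> y \<otimes> inv z) \<otimes> inv x"
      if "y \<in> carrier G" for y
      using x z that by (simp add: inv_mult_group m_assoc)
    then show "x \<otimes> z \<in> ?L" using x z by simp
  next
    fix x assume x: "x \<in> ?L"
    have "inv x \<otimes> y \<otimes> inv (inv x) \<in> M \<longleftrightarrow> y \<in> M" if y: "y \<in> carrier G" for y
    proof -
      have "x \<otimes> (inv x \<otimes> y \<otimes> inv (inv x)) \<otimes> inv x = y"
        using x y by (simp add: m_assoc) (simp add: m_assoc[symmetric])
      moreover have "inv x \<otimes> y \<otimes> inv (inv x) \<in> carrier G" using x y by simp
      ultimately show ?thesis using x by force
    qed
    then show "inv x \<in> ?L" using x by simp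
  qed auto
  have MsubL: "M \<subseteq> ?L"
  proof
    fix m assume m: "m \<in> M"
    have "y \<in> M" if y: "y \<in> carrier G" "m \<otimes> y \<otimes> inv m \<in> M" for y
    proof -
      have "inv m \<otimes> (m \<otimes> y \<otimes> inv m) \<otimes> m \<in> M" using m y by blast
      moreover have "inv m \<otimes> (m \<otimes> y \<otimes> inv m) \<otimes> m = y"
        using m y(1) by (simp add: m_assoc) (simp add: m_assoc[symmetric])
      ultimately show ?thesis by simp
    qed
    moreover have "m \<otimes> y \<otimes> inv m \<in> M" if "y \<in> M" for y using m that by blast
    ultimately show "m \<in> ?L" using M.mem_carrier[OF m] by blast
  qed
  have "g \<in> ?L" using g(1) c c' by blast
  then have "?L = carrier G" using gM maximal_open_subgroupD[OF M L MsubL] by blast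
  then have "x \<otimes> m \<otimes> inv x \<in> M" if "x \<in> carrier G" "m \<in> M" for x m
    using that M.mem_carrier by blast
  then show ?thesis unfolding normal_inv_iff using Ms(1) by blast
qed

text \<open>The quotient by \<open>M\<close> is a nontrivial \<open>p\<close>-group and has a
  subgroup of order \<open>p\<close>; the union of its cosets lies strictly above \<open>M\<close>,
  so it is \<open>G\<close>.\<close>

lemma maximal_open_subgroup_index:
  assumes fg: "top_finitely_generated G T" and M: "maximal_open_subgroup G T M"
  shows "index_le M p"
proof -
  have Ms: "subgroup M G" "openin T M" "M \<noteq> carrier G"
    using M by (auto simp: maximal_open_subgroup_def)
  interpret M: normal M G by (rule maximal_open_subgroup_normal[OF assms])
  let ?Q = "G Mod M"
  interpret Q: group ?Q by (rule M.factorgroup_is_group)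
  have Qc: "carrier ?Q = rcosets M" by (simp add: FactGroup_def)
  obtain k where k: "order ?Q = p ^ k"
    using open_normal_index[OF M.normal_axioms Ms(2)] by blast
  have fin: "finite (carrier ?Q)" using finite_rcosets_open[OF Ms(1,2)] Qc by simp
  have "k \<noteq> 0"
  proof
    assume "k = 0"
    then have triv: "carrier ?Q = {M}" using k Q.order_one_triv_iff by simp
    have "x \<in> M" if x: "x \<in> carrier G" for x
    proof -
      have "M #> x = M" using x triv Qc rcosetsI[OF M.subset x] by auto
      then show ?thesis using rcos_self[OF x Ms(1)] by simp
    qed
    then show False using Ms(3) M.subset by blast
  qed
  \<comment> \<open>Splitting off a single factor \<open>p\<close> makes Sylow's existence theorem
    yield a subgroup of order exactly \<open>p\<close>.\<close>
  then have "order ?Q = p ^ 1 * p ^ (k - 1)" using k by (cases k) auto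
  from sylow_thm[OF prime_p Q.is_group this fin]
  obtain A where A: "subgroup A ?Q" "card A = p" by auto
  interpret A: subgroup A ?Q by (rule A(1))
  have U: "subgroup (\<Union>A) G" by (rule M.factgroup_subgroup_union_subgroup[OF A(1)])
  have Ueq: "\<Union>A = {x \<in> carrier G. M #> x \<in> A}" by (rule M.factgroup_subgroup_union_char[OF A(1)])
  have MU: "M \<subseteq> \<Union>A" using A.one_closed by auto
  have "\<Union>A \<noteq> M"
  proof
    assume eq: "\<Union>A = M"
    have "X = M" if X: "X \<in> A" for X
    proof -
      obtain x where x: "x \<in> carrier G" "X = M #> x"
        using A.subset X by (auto simp: carrier_FactGroup)
      then have "x \<in> M" using X eq Ueq by blast
      then show ?thesis using x coset_join2[OF x(1) Ms(1)] by simp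
    qed
    moreover have "M \<in> A" using A.one_closed by simp
    ultimately have "A = {M}" by blast
    then show False using A(2) prime_gt_1_nat[OF prime_p] by simp
  qed
  then have Ac: "\<Union>A = carrier G" using maximal_open_subgroupD[OF M U MU] by blast
  have "rcosets M \<subseteq> A"
  proof
    fix X assume "X \<in> rcosets M"
    then obtain x where x: "x \<in> carrier G" "X = M #> x" by (auto simp: RCOSETS_def)
    then have "x \<in> \<Union>A" using Ac by simp
    then show "X \<in> A" using x(2) unfolding Ueq by blast
  qed
  then have "A = rcosets M" using A.subset Qc by blast
  then have "card (rcosets M) = p" using A(2) by simp
  then show ?thesis using index_le_card_rcosets[OF Ms(1)] fin Qc by simp
qed

text \<open>Every maximal open subgroup has index at most \<open>p\<close>. As the core is open,
  this makes the Frattini quotient finite.\<close>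

lemma index_core_subset_Frattini:
  assumes fg: "top_finitely_generated G T"
  shows "index_core p \<subseteq> Frattini G T"
proof
  fix x assume x: "x \<in> index_core p"
  have "x \<in> M" if M: "maximal_open_subgroup G T M" for M
    using index_core_subset[OF _ _ maximal_open_subgroup_index[OF fg M]] M x
    by (auto simp: maximal_open_subgroup_def)
  then show "x \<in> Frattini G T" using x by (auto simp: Frattini_def index_core_def)
qed

lemma openin_Frattini: "top_finitely_generated G T \<Longrightarrow> openin T (Frattini G T)"
  using openin_supergroup[OF Frattini_subgroup index_core_subgroup openin_index_core
      index_core_subset_Frattini] by blast

text \<open>The preimage of a maximal open subgroup under an endomorphism is again maximal, or it is
  everything.\<close>

lemma Frattini_invariant:
  assumes fg: "top_finitely_generated G T" and \<psi>: "\<psi> \<in> cont_End G T" and x: "x \<in> Frattini G T"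
  shows "\<psi> x \<in> Frattini G T"
proof -
  interpret h: group_hom G G \<psi> by (rule cont_EndD(1)[OF \<psi>])
  have xc: "x \<in> carrier G" using x by (simp add: Frattini_def)
  have "\<psi> x \<in> M" if M: "maximal_open_subgroup G T M" for M
  proof -
    have Ms: "subgroup M G" "openin T M" using M by (auto simp: maximal_open_subgroup_def)
    interpret M: normal M G by (rule maximal_open_subgroup_normal[OF fg M])
    let ?P = "{x \<in> carrier G. \<psi> x \<in> M}"
    have P: "subgroup ?P G" by (rule h.subgroup_vimage[OF Ms(1)])
    have max: "H = ?P \<or> H = carrier G" if H: "subgroup H G" "?P \<subseteq> H" for H
    proof -
      interpret H: subgroup H G by (rule H(1))
      \<comment> \<open>A subgroup \<open>H\<close> above \<open>?P\<close> gives \<open>?N\<close>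
        above \<open>M\<close>. If \<open>?N\<close> is \<open>M\<close>, then \<open>H\<close> is
        inside \<open>?P\<close>. If \<open>?N\<close> is \<open>G\<close>, each
        \<open>\<psi> g\<close> is \<open>m \<otimes> \<psi> z\<close>, and
        \<open>g \<otimes> inv z\<close> lies in \<open>?P\<close>, hence in
        \<open>H\<close>.\<close>
      let ?N = "M <#> \<psi> ` H"
      have N: "subgroup ?N G"
        by (rule mult_norm_subgroup[OF M.normal_axioms h.subgroup_img_is_subgroup[OF H(1)]])
      have MN: "M \<subseteq> ?N"
      proof
        fix m assume "m \<in> M"
        then have "m \<otimes> \<psi> \<one> \<in> ?N" unfolding set_mult_def using H.one_closed by blast
        then show "m \<in> ?N" using \<open>m \<in> M\<close> by simp
      qed
      have "?N = M \<or> ?N = carrier G"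
        by (rule maximal_open_subgroupD[OF M N MN])
      then show ?thesis
      proof
        assume N: "?N = M"
        have "\<psi> z \<in> M" if "z \<in> H" for z
        proof -
          have "\<one> \<otimes> \<psi> z \<in> ?N" unfolding set_mult_def using that M.one_closed by blast
          then show ?thesis using N that by simp
        qed
        then show ?thesis using H H.subset by auto
      next
        assume N: "?N = carrier G"
        have "g \<in> H" if g: "g \<in> carrier G" for g
        proof -
          have "\<psi> g \<in> ?N" using N g by simp
          then obtain m z where mz: "m \<in> M" "z \<in> H" "\<psi> g = m \<otimes> \<psi> z"
            unfolding set_mult_def by blast
          then have "\<psi> (g \<otimes> inv z) = m" using g by (simp add: m_assoc)
          then have "g \<otimes> inv z \<in> H" using mz g H(2) by auto
          then have "g \<otimes> inv z \<otimes> z \<in> H" using mz by blast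
          then show ?thesis using g mz by (simp add: m_assoc)
        qed
        then show ?thesis using H.subset by blast
      qed
    qed
    show ?thesis
    proof (cases "?P = carrier G")
      case True
      then show ?thesis using xc by blast
    next
      case False
      then have "maximal_open_subgroup G T ?P"
        using P max openin_vimage[OF \<psi> Ms(2)] by (auto simp: maximal_open_subgroup_def)
      then show ?thesis using x by (auto simp: Frattini_def)
    qed
  qed
  then show ?thesis using xc by (auto simp: Frattini_def)
qed

section \<open>Surjectivity modulo the Frattini subgroup and the Hopf property\<close>

text \<open>Each core times the image is \<open>G\<close> by the Frattini argument, so
  \<open>\<psi>\<close> is onto, hence one-to-one, modulo every core. The cores intersect trivially,
  which gives injectivity; compactness gives surjectivity, and a continuous bijection of a compact
  Hausdorff space is a homeomorphism.\<close>

lemma cont_Aut_if_surj_mod_Frattini: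
  assumes fg: "top_finitely_generated G T" and \<psi>: "\<psi> \<in> cont_End G T"
    and surj: "\<And>g. g \<in> carrier G \<Longrightarrow> \<exists>x\<in>carrier G. \<psi> x \<otimes> inv g \<in> Frattini G T"
  shows "\<psi> \<in> cont_Aut G T"
proof -
  interpret h: group_hom G G \<psi> by (rule cont_EndD(1)[OF \<psi>])
  have dense: "\<exists>x\<in>carrier G. \<psi> x \<otimes> inv g \<in> index_core n" if g: "g \<in> carrier G" for g n
  proof -
    let ?K = "index_core n" and ?A = "index_core n <#> \<psi> ` carrier G"
    interpret K: normal ?K G by (rule index_core_normal)
    have A: "subgroup ?A G"
      by (rule mult_norm_subgroup[OF index_core_normal
            h.subgroup_img_is_subgroup[OF subgroup_self]])
    have KA: "?K \<subseteq> ?A"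
    proof
      fix k assume k: "k \<in> ?K"
      then have "k \<otimes> \<psi> \<one> \<in> ?A" unfolding set_mult_def using one_closed by blast
      then show "k \<in> ?A" using k by simp
    qed
    have img: "\<psi> x \<in> ?A" if "x \<in> carrier G" for x
    proof -
      have "\<one> \<otimes> \<psi> x \<in> ?A" unfolding set_mult_def using that K.one_closed by blast
      then show ?thesis using that by simp
    qed
    have "?A = carrier G"
    proof (rule eq_carrier_if_supplements_Frattini[OF A])
      show "openin T ?A"
        by (rule openin_supergroup[OF A index_core_subgroup openin_index_core[OF fg] KA])
      show "\<exists>a\<in>?A. a \<otimes> inv y \<in> Frattini G T" if "y \<in> carrier G" for y
        using surj[OF that] img by blast
    qed
    then have "g \<in> ?A" using g by simp
    then obtain k x where kx: "k \<in> ?K" "x \<in> carrier G" "g = k \<otimes> \<psi> x"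
      unfolding set_mult_def by blast
    have "\<psi> x \<otimes> inv g = inv k"
      unfolding kx(3) using kx(1,2) by (simp add: inv_mult_group m_assoc[symmetric])
    then have "\<psi> x \<otimes> inv g \<in> ?K" using kx(1) by simp
    then show ?thesis using kx(2) by blast
  qed
  have inj1: "x \<in> index_core n" if "x \<in> carrier G" "\<psi> x \<in> index_core n" for x n
    using finite_index_inj_iff_surj[OF index_core_subgroup
        finite_rcosets_open[OF index_core_subgroup openin_index_core[OF fg]] cont_EndD(1)[OF \<psi>]
        index_core_invariant[OF \<psi>]] dense that by blast
  have "x = \<one>" if "x \<in> carrier G" "\<psi> x = \<one>" for x
    using exists_index_core_notin[OF that(1)] inj1[OF that(1)] that(2)
      subgroup.one_closed[OF index_core_subgroup] by metis
  then have inj: "inj_on \<psi> (carrier G)" by (subst h.inj_on_one_iff) blast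
  have "g \<in> \<psi> ` carrier G" if g: "g \<in> carrier G" for g
  proof -
    \<comment> \<open>\<open>?D n\<close> collects the solutions of \<open>\<psi> x = g\<close>
      modulo \<open>index_core n\<close>; these closed sets decrease as \<open>n\<close>
      grows.\<close>
    let ?D = "\<lambda>n. {x \<in> topspace T. \<psi> x \<otimes> inv g \<in> index_core n}"
    have cont: "continuous_map T T (\<lambda>x. \<psi> x \<otimes> inv g)"
      using continuous_map_compose[OF cont_EndD(2)[OF \<psi>] continuous_map_mult_right[of "inv g"]] g
      by (simp add: o_def)
    have anti: "index_core m \<subseteq> index_core n" if "n \<le> m" for m n
      using index_le_mono that by (auto simp: index_core_def)
    have "\<Inter>(range ?D) \<noteq> {}"
    proof (rule compact[unfolded compact_space_fip, rule_format], intro conjI ballI allI impI)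
      fix C assume "C \<in> range ?D"
      then show "closedin T C"
        using closedin_continuous_map_preimage[OF cont closedin_open_subgroup[OF
              index_core_subgroup openin_index_core[OF fg]]] by auto
    next
      fix F assume F: "finite F \<and> F \<subseteq> range ?D"
      then obtain I where I: "finite I" "F = ?D ` I" by (meson finite_subset_image)
      \<comment> \<open>The largest index gives the smallest core; inserting 0 covers the empty
        subfamily.\<close>
      obtain x where x: "x \<in> carrier G" "\<psi> x \<otimes> inv g \<in> index_core (Max (insert 0 I))"
        using dense[OF g] by blast
      have "index_core (Max (insert 0 I)) \<subseteq> index_core i" if "i \<in> I" for i
        using I(1) that by (intro anti Max_ge) auto
      then have "x \<in> \<Inter>F" using x I(2) by (auto simp: topspace_eq_carrier)
      then show "\<Inter>F \<noteq> {}" by blast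
    qed
    then obtain x where x: "x \<in> carrier G" "\<And>n. \<psi> x \<otimes> inv g \<in> index_core n"
      by (auto simp: topspace_eq_carrier)
    then have "\<psi> x \<otimes> inv g = \<one>"
      using exists_index_core_notin[of "\<psi> x \<otimes> inv g"] g by auto
    then have "\<psi> x = g" using x(1) g by (metis h.hom_closed inv_closed inv_equality inv_inv)
    then show ?thesis using x(1) by blast
  qed
  then have surj': "\<psi> ` carrier G = carrier G" by auto
  then have "homeomorphic_map T T \<psi>"
    using continuous_imp_homeomorphic_map[OF cont_EndD(2)[OF \<psi>] compact Hausdorff] inj
    by (simp add: topspace_eq_carrier)
  then show ?thesis
    using inj surj' h.homh by (simp add: cont_Aut_def iso_def bij_betw_def)
qed

section \<open>Iterates of an endomorphism with image in the Frattini subgroup\<close>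

lemma funpow_eventually_in_index_core:
  assumes fg: "top_finitely_generated G T" and \<psi>: "\<psi> \<in> cont_End G T"
    and img: "\<And>x. x \<in> carrier G \<Longrightarrow> \<psi> x \<in> Frattini G T"
  shows "\<exists>m. \<forall>x\<in>carrier G. (\<psi> ^^ m) x \<in> index_core n"
proof -
  interpret h: group_hom G G \<psi> by (rule cont_EndD(1)[OF \<psi>])
  interpret F: normal "Frattini G T" G by (rule Frattini_normal)
  let ?K = "index_core n"
  \<comment> \<open>An ascending chain of subgroups above \<open>?K\<close>, of which there are only
    finitely many.\<close>
  define A where "A i = {x \<in> carrier G. (\<psi> ^^ i) x \<in> ?K}" for i
  have op: "openin T ?K" by (rule openin_index_core[OF fg])
  have A: "subgroup (A i) G" for i
    unfolding A_def
    by (rule group_hom.subgroup_vimage[OF cont_EndD(1)[OF cont_End_funpow[OF \<psi>]]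
          index_core_subgroup])
  have mono: "A i \<subseteq> A (Suc i)" for i
    using index_core_invariant[OF \<psi>] by (auto simp: A_def)
  have KA: "?K \<subseteq> A i" for i
    using index_core_invariant[OF cont_End_funpow[OF \<psi>]] subgroup.mem_carrier[OF index_core_subgroup]
    by (auto simp: A_def)
  have fin: "finite (range A)"
    by (rule finite_subset[OF _ finite_supergroups[OF index_core_subgroup
            finite_rcosets_open[OF index_core_subgroup op]]]) (use A KA in auto)
  have "A 0 \<in> range A" by blast
  from finite_has_maximal2[OF fin this] obtain i where "\<forall>B\<in>range A. A i \<subseteq> B \<longrightarrow> A i = B"
    by blast
  then have eq: "A i = A (Suc i)" using mono by blast
  have opA: "openin T (A i)" by (rule openin_supergroup[OF A index_core_subgroup op KA])
  \<comment> \<open>Stabilisation says that \<open>A i\<close> is its own preimage, which is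
    injectivity of \<open>\<psi>\<close> on its cosets; finiteness turns this into
    surjectivity.\<close>
  have inv: "\<psi> x \<in> A i \<longleftrightarrow> x \<in> A i" if x: "x \<in> carrier G" for x
  proof -
    have "\<psi> x \<in> A i \<longleftrightarrow> x \<in> A (Suc i)" using x by (simp add: A_def funpow_swap1)
    then show ?thesis using eq by simp
  qed
  have "A i = carrier G"
  proof (rule eq_carrier_if_supplements_Frattini[OF A opA])
    fix g assume g: "g \<in> carrier G"
    have "\<exists>x\<in>carrier G. \<psi> x \<otimes> inv g \<in> A i"
      using finite_index_inj_iff_surj[OF A finite_rcosets_open[OF A opA] h.group_hom_axioms] inv g
        subgroup.mem_carrier[OF A] by blast
    then obtain x where x: "x \<in> carrier G" "\<psi> x \<otimes> inv g \<in> A i" by blast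
    \<comment> \<open>The witness is \<open>g \<otimes> inv (\<psi> x)\<close>, an element of
      \<open>A i\<close>; modulo \<open>g\<close> on the right it becomes a conjugate of
      \<open>inv (\<psi> x)\<close>.\<close>
    have "g \<otimes> inv (\<psi> x) \<otimes> inv g \<in> Frattini G T"
      using F.inv_op_closed2[OF g F.m_inv_closed[OF img[OF x(1)]]] .
    moreover have "inv (\<psi> x \<otimes> inv g) = g \<otimes> inv (\<psi> x)"
      using x g by (simp add: inv_mult_group)
    ultimately show "\<exists>a\<in>A i. a \<otimes> inv g \<in> Frattini G T"
      using subgroup.m_inv_closed[OF A x(2)] by metis
  qed
  then show ?thesis by (auto simp: A_def)
qed

section \<open>Descent to an endomorphism with image in the Frattini subgroup\<close>

lemma cont_Aut_transitive:
  assumes tr: "Aut_transitive_mod_Frattini G T"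
    and a: "a \<in> carrier G" "a \<notin> Frattini G T" and b: "b \<in> carrier G" "b \<notin> Frattini G T"
  shows "\<exists>\<alpha>\<in>cont_Aut G T. \<alpha> a \<otimes> inv b \<in> Frattini G T"
proof -
  let ?F = "Frattini G T" and ?Q = "G Mod Frattini G T"
  have mem: "?F #> x \<in> carrier ?Q - {\<one>\<^bsub>?Q\<^esub>}" if x: "x \<in> carrier G" "x \<notin> ?F" for x
    using x rcos_self[OF x(1) Frattini_subgroup] by (auto simp: carrier_FactGroup)
  obtain \<alpha> where \<alpha>: "\<alpha> \<in> cont_Aut G T" "\<alpha> ` (?F #> a) = ?F #> b"
    using tr mem[OF a] mem[OF b] unfolding Aut_transitive_mod_Frattini_def Let_def by metis
  have "\<alpha> a \<in> ?F #> b" using \<alpha>(2) rcos_self[OF a(1) Frattini_subgroup] by blast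
  then have "\<alpha> a \<otimes> inv b \<in> ?F"
    by (rule subgroup.rcos_module_imp[OF Frattini_subgroup is_group b(1)])
  with \<alpha>(1) show ?thesis by blast
qed

text \<open>Induction on the size of the image modulo the Frattini subgroup. The element
  \<open>y\<close> witnesses a nontrivial kernel there and serves every stage unchanged.\<close>

lemma exists_image_in_Frattini:
  assumes fg: "top_finitely_generated G T" and tr: "Aut_transitive_mod_Frattini G T"
    and comp: "\<And>\<psi> \<rho>. \<lbrakk>\<psi> \<in> E; \<rho> \<in> E\<rbrakk> \<Longrightarrow> \<psi> \<circ> \<rho> \<in> E"
    and E: "E \<subseteq> cont_End G T" and Aut: "\<And>\<psi> \<alpha>. \<lbrakk>\<psi> \<in> E; \<alpha> \<in> cont_Aut G T\<rbrakk> \<Longrightarrow> \<alpha> \<circ> \<psi> \<in> E"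
    and \<psi>: "\<psi> \<in> E" and y: "y \<in> carrier G" "y \<notin> Frattini G T" "\<psi> y \<in> Frattini G T"
  shows "\<exists>\<rho>\<in>E. \<forall>x\<in>carrier G. \<rho> x \<in> Frattini G T"
  using \<psi> y
proof (induction "card ((\<lambda>x. Frattini G T #> \<psi> x) ` carrier G)" arbitrary: \<psi> y rule: less_induct)
  case less
  let ?F = "Frattini G T"
  have \<psi>: "\<psi> \<in> cont_End G T" using E less.prems(1) by blast
  interpret h: group_hom G G \<psi> by (rule cont_EndD(1)[OF \<psi>])
  interpret F: subgroup ?F G by (rule Frattini_subgroup)
  show ?case
  proof (cases "\<forall>x\<in>carrier G. \<psi> x \<in> ?F")
    case True
    then show ?thesis using less.prems(1) by blast
  next
    case False
    then obtain x where x: "x \<in> carrier G" "\<psi> x \<notin> ?F" by blast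
    \<comment> \<open>\<open>\<alpha>\<close> moves the nontrivial image class of
      \<open>\<psi> x\<close> to the kernel class of \<open>y\<close>, so a second application of
      \<open>\<psi>\<close> kills \<open>x\<close>.\<close>
    obtain \<alpha> where \<alpha>: "\<alpha> \<in> cont_Aut G T" "\<alpha> (\<psi> x) \<otimes> inv y \<in> ?F"
      using cont_Aut_transitive[OF tr h.hom_closed[OF x(1)] x(2) less.prems(2,3)] by blast
    interpret a: group_hom G G \<alpha> by (rule cont_EndD(1)[OF cont_Aut_imp_cont_End[OF \<alpha>(1)]])
    have inv: "\<psi> z \<in> ?F" "\<alpha> z \<in> ?F" if "z \<in> ?F" for z
      using Frattini_invariant[OF fg] \<psi> cont_Aut_imp_cont_End[OF \<alpha>(1)] that by blast+
    let ?\<rho> = "\<psi> \<circ> (\<alpha> \<circ> \<psi>)"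
    have \<rho>: "?\<rho> \<in> E" using less.prems(1) \<alpha>(1) comp Aut by blast
    have "\<psi> (\<alpha> (\<psi> x)) \<otimes> inv (\<psi> y) \<in> ?F" using inv(1)[OF \<alpha>(2)] x less.prems(2) by simp
    then have "\<psi> (\<alpha> (\<psi> x)) \<otimes> inv (\<psi> y) \<otimes> \<psi> y \<in> ?F" using less.prems(4) by blast
    then have \<rho>x: "?\<rho> x \<in> ?F" using x less.prems(2) by (simp add: m_assoc)
    have \<rho>y: "?\<rho> y \<in> ?F" using inv less.prems(4) by simp
    \<comment> \<open>\<open>?\<rho>\<close> factors through \<open>\<psi>\<close> and identifies
      \<open>x\<close> with \<one>, which \<open>\<psi>\<close> keeps apart.\<close>
    have "card ((\<lambda>x. ?F #> ?\<rho> x) ` carrier G) < card ((\<lambda>x. ?F #> \<psi> x) ` carrier G)"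
    proof (rule card_image_less_if_factors)
      have "(\<lambda>x. ?F #> \<psi> x) ` carrier G \<subseteq> rcosets ?F"
        by (auto intro!: rcosetsI F.subset)
      then show "finite ((\<lambda>x. ?F #> \<psi> x) ` carrier G)"
        using finite_rcosets_open[OF Frattini_subgroup openin_Frattini[OF fg]] finite_subset
        by blast
    next
      fix v w assume vw: "v \<in> carrier G" "w \<in> carrier G" "?F #> \<psi> v = ?F #> \<psi> w"
      then have "\<psi> v \<otimes> inv (\<psi> w) \<in> ?F" by (simp add: rcoset_eq_iff Frattini_subgroup)
      then have "\<psi> (\<alpha> (\<psi> v \<otimes> inv (\<psi> w))) \<in> ?F" by (intro inv)
      moreover have "\<psi> (\<alpha> (\<psi> v \<otimes> inv (\<psi> w))) = ?\<rho> v \<otimes> inv (?\<rho> w)"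
        using vw by (simp del: h.hom_inv a.hom_inv add: h.hom_inv[symmetric] a.hom_inv[symmetric])
      ultimately show "?F #> ?\<rho> v = ?F #> ?\<rho> w"
        using vw by (simp add: rcoset_eq_iff Frattini_subgroup)
    next
      show "x \<in> carrier G" by (rule x(1))
      show "\<one> \<in> carrier G" by (rule one_closed)
      show "?F #> ?\<rho> x = ?F #> ?\<rho> \<one>"
        using \<rho>x x(1) by (simp add: rcoset_eq_iff Frattini_subgroup)
      show "?F #> \<psi> x \<noteq> ?F #> \<psi> \<one>"
        using x by (simp add: rcoset_eq_iff Frattini_subgroup)
    qed
    then show ?thesis using less.hyps[OF _ \<rho> less.prems(2,3) \<rho>y] by blast
  qed
qed

end

section \<open>Endomorphisms preserving an automorphic orbit\<close>

theorem theorem4p5: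
  fixes G :: "('a, 'b) monoid_scheme" and T :: "'a topology" and p :: nat
    and u :: 'a and \<phi> :: "'a \<Rightarrow> 'a"
  assumes "pro_p_group G T p"
    and "top_finitely_generated G T"
    and "Aut_transitive_mod_Frattini G T"
    and "u \<in> carrier G" and "u \<noteq> \<one>\<^bsub>G\<^esub>"
    and "\<phi> \<in> cont_End G T"
    and "\<phi> ` Orb G T u \<subseteq> Orb G T u"
  shows "\<phi> \<in> cont_Aut G T"
proof (rule ccontr)
  interpret pro_p_group G T p by (rule assms(1))
  note fg = assms(2) and tr = assms(3)
  assume not_Aut: "\<phi> \<notin> cont_Aut G T"
  interpret h: group_hom G G \<phi> by (rule cont_EndD(1)[OF assms(6)])
  let ?F = "Frattini G T"
  \<comment> \<open>On the finite Frattini quotient a failure of surjectivity is a failure of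
    injectivity, which provides \<open>y\<close>.\<close>
  have "\<not> (\<forall>g\<in>carrier G. \<exists>x\<in>carrier G. \<phi> x \<otimes>\<^bsub>G\<^esub> inv\<^bsub>G\<^esub> g \<in> ?F)"
    using cont_Aut_if_surj_mod_Frattini[OF fg assms(6)] not_Aut by blast
  then obtain y where y: "y \<in> carrier G" "y \<notin> ?F" "\<phi> y \<in> ?F"
    using finite_index_inj_iff_surj[OF Frattini_subgroup
        finite_rcosets_open[OF Frattini_subgroup openin_Frattini[OF fg]] h.group_hom_axioms
        Frattini_invariant[OF fg assms(6)]] by blast
  let ?E = "{\<psi> \<in> cont_End G T. \<psi> ` Orb G T u \<subseteq> Orb G T u}"
  have Orb_Aut: "\<alpha> z \<in> Orb G T u" if \<alpha>: "\<alpha> \<in> cont_Aut G T" and z: "z \<in> Orb G T u" for \<alpha> z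
  proof -
    obtain \<beta> where \<beta>: "\<beta> \<in> cont_Aut G T" "z = \<beta> u" using z by (auto simp: Orb_def)
    have "\<alpha> \<circ> \<beta> \<in> cont_Aut G T"
      using \<alpha> \<beta>(1) by (auto simp: cont_Aut_def intro: iso_set_trans homeomorphic_map_compose)
    then have "(\<alpha> \<circ> \<beta>) u \<in> Orb G T u" unfolding Orb_def by blast
    then show ?thesis using \<beta>(2) by simp
  qed
  have "\<exists>\<rho>\<in>?E. \<forall>x\<in>carrier G. \<rho> x \<in> ?F"
  proof (rule exists_image_in_Frattini[where E = ?E and \<psi> = \<phi>, OF fg tr _ _ _ _ y])
    show "\<psi> \<circ> \<rho> \<in> ?E" if "\<psi> \<in> ?E" "\<rho> \<in> ?E" for \<psi> \<rho>
      using that cont_End_compose by (auto simp: image_subset_iff)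
    show "\<alpha> \<circ> \<psi> \<in> ?E" if "\<psi> \<in> ?E" "\<alpha> \<in> cont_Aut G T" for \<psi> \<alpha>
    proof -
      have "\<alpha> \<circ> \<psi> \<in> cont_End G T"
        using that cont_End_compose[OF cont_Aut_imp_cont_End] by blast
      moreover have "(\<alpha> \<circ> \<psi>) z \<in> Orb G T u" if "z \<in> Orb G T u" for z
        using Orb_Aut[OF \<open>\<alpha> \<in> cont_Aut G T\<close>, of "\<psi> z"] \<open>\<psi> \<in> ?E\<close> that by auto
      ultimately show ?thesis by blast
    qed
  qed (use assms in auto)
  then obtain \<rho> where \<rho>: "\<rho> \<in> ?E" "\<And>x. x \<in> carrier G \<Longrightarrow> \<rho> x \<in> ?F" by blast
  obtain n where n: "u \<notin> index_core n" using exists_index_core_notin assms by blast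
  have "\<rho> \<in> cont_End G T" using \<rho>(1) by blast
  from funpow_eventually_in_index_core[OF fg this \<rho>(2)]
  obtain m where m: "\<forall>x\<in>carrier G. (\<rho> ^^ m) x \<in> index_core n" by (rule exE)
  have "id \<in> cont_Aut G T" by (auto simp: cont_Aut_def iso_def hom_def)
  then have "u \<in> Orb G T u" by (auto simp: Orb_def intro!: exI[of _ id])
  then have "(\<rho> ^^ k) u \<in> Orb G T u" for k
    using \<rho>(1) by (induction k) (auto simp: image_subset_iff)
  then obtain \<alpha> where \<alpha>: "\<alpha> \<in> cont_Aut G T" "(\<rho> ^^ m) u = \<alpha> u" by (auto simp: Orb_def)
  \<comment> \<open>The iterate of \<open>u\<close> lies in the core and is
    \<open>\<alpha> u\<close>; the core is invariant under the inverse of \<open>\<alpha>\<close>,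
    so it contains \<open>u\<close>, against the choice of \<open>n\<close>.\<close>
  have "inv_into (carrier G) \<alpha> (\<alpha> u) \<in> index_core n"
    using index_core_invariant[OF cont_Aut_imp_cont_End[OF cont_Aut_inv[OF \<alpha>(1)]]]
      bspec[OF m assms(4)] \<alpha>(2) by simp
  moreover have "inv_into (carrier G) \<alpha> (\<alpha> u) = u"
    using \<alpha>(1) assms(4) by (auto simp: cont_Aut_def iso_def bij_betw_def)
  ultimately show False using n by simp
qed

end
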